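(* Let $R>0$ and $\mu\in\mathbb{R}$ with $\mu R\le 3/2$. If $f_1,f_2\in C_c^\infty(D_R)$ satisfy $\mathcal{V}_\mu f_1=\mathcal{V}_\mu f_2$, then $f_1=f_2$.
   Context: $D_R:=\{x\in\mathbb{R}^2 : \|x\|<R\}$ is the open disc of radius $R$, and $C_c^\infty(D_R)$ is the set of all smooth functions $f:\mathbb{R}^2\to\mathbb{R}$ with $\operatorname{supp}(f)\subseteq D_R$. For $\varphi\in\mathbb{R}$, $\Phi(\varphi):=(\cos\varphi,\sin\varphi)$. The attenuated V-line transform $\mathcal{V}_\mu f:[0,2\pi)\times(0,\pi/2)\to\mathbb{R}$ of $f\in C_c^\infty(D_R)$ with attenuation parameter $\mu\in\mathbb{R}$ is $$\mathcal{V}_\mu f(\varphi,\psi):=\sum_{\sigma=\pm1}\int_0^\infty f\bigl(R\,\Phi(\varphi)-r\,\Phi(\varphi-\sigma\psi)\bigr)\,e^{-\mu r}\,\mathrm{d}r.$$ *)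

theory Defs
  imports "HOL-Analysis.Analysis"
begin

text \<open>
  On a finite-dimensional space \<open>C_diff k\<close> is the usual class \<open>C\<^sup>k\<close>: continuity of the derivative
  as a linear map amounts to continuity of all directional derivatives.
\<close>

primrec C_diff :: "nat \<Rightarrow> ('a::real_normed_vector \<Rightarrow> 'b::real_normed_vector) \<Rightarrow> bool" where
  "C_diff 0 f \<longleftrightarrow> continuous_on UNIV f"
| "C_diff (Suc k) f \<longleftrightarrow>
     (\<forall>x. f differentiable (at x)) \<and> (\<forall>v. C_diff k (\<lambda>x. frechet_derivative f (at x) v))"

definition smooth :: "('a::real_normed_vector \<Rightarrow> 'b::real_normed_vector) \<Rightarrow> bool" where
  "smooth f \<longleftrightarrow> (\<forall>k. C_diff k f)"

definition supp :: "('a::topological_space \<Rightarrow> 'b::zero) \<Rightarrow> 'a set" where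
  "supp f = closure {x. f x \<noteq> 0}"

definition disc :: "real \<Rightarrow> (real^2) set" where
  "disc R = ball 0 R"

text \<open>
  Compactness of the support is not required separately: the support is closed by definition,
  so it is compact as soon as it is contained in the bounded set \<open>disc R\<close>.
\<close>

definition Cc_infty_disc :: "real \<Rightarrow> (real^2 \<Rightarrow> real) set" where
  "Cc_infty_disc R = {f. smooth f \<and> supp f \<subseteq> disc R}"

definition unit_dir :: "real \<Rightarrow> real^2" where
  "unit_dir \<phi> = vector [cos \<phi>, sin \<phi>]"

text \<open>
  The integrand is continuous with compact support in \<open>r\<close> when \<open>f \<in> Cc_infty_disc R\<close>, so
  the Lebesgue integral is the one meant in the classical definition. The transform is considered
  only for \<open>\<phi> \<in> {0..<2 * pi}\<close> and \<open>\<psi> \<in> {0<..<pi / 2}\<close>.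
\<close>

definition vline_transform :: "real \<Rightarrow> real \<Rightarrow> (real^2 \<Rightarrow> real) \<Rightarrow> real \<Rightarrow> real \<Rightarrow> real" where
  "vline_transform R \<mu> f \<phi> \<psi> =
     (\<Sum>\<sigma>\<in>{1, -1}.
        LBINT r:{0..}. f (R *\<^sub>R unit_dir \<phi> - r *\<^sub>R unit_dir (\<phi> - \<sigma> * \<psi>)) * exp (- \<mu> * r))"

end

theory Submission
  imports Defs
begin

text \<open>
  By linearity it suffices to show that a smooth \<open>f\<close>, vanishing outside a disc of radius \<open>R' < R\<close>,
  is zero when its transform is zero. The transform commutes with rotations, so it acts separately
  on each Fourier mode of \<open>f\<close>. Write \<open>a \<rho>\<close> for the integral of \<open>f\<close> over the circle of radius \<open>\<rho>\<close>
  against \<open>\<lambda>\<theta>. cos (n * \<theta> - \<gamma>)\<close>. The lines that contain the two rays have distance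
  \<open>s = R * sin \<psi>\<close> from the origin. With \<open>t\<close> the coordinate on the line measured from the foot of the
  perpendicular, the point at \<open>t\<close> has radius \<open>sqrt (s\<^sup>2 + t\<^sup>2)\<close>. Integrating the vanishing transform
  over \<open>\<phi>\<close> and folding \<open>t\<close> with \<open>- t\<close> gives a generalized Abel equation, for
  \<open>p = s\<^sup>2\<close> in \<open>{0<..<R\<^sup>2}\<close> and \<open>b q = a (sqrt q)\<close> (lemma \<open>circle_moment_abel_equation\<close>):
  the integral of \<open>b (p + t\<^sup>2) * K p t\<close> over \<open>t \<in> {0..R}\<close> is zero, where \<open>K p\<close> is even in \<open>t\<close> and
  smooth, and \<open>K p 0 = 2 * cos (n * arccos (sqrt p / R))\<close>.

  The difficulty is that \<open>K p 0\<close> has zeros, all of them simple. Suppose that \<open>b\<close> vanishes on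
  \<open>{B..}\<close>, where \<open>B > 0\<close>, and let \<open>G\<close> be the antiderivative of \<open>- b\<close> with \<open>G B = 0\<close>. Let \<open>A\<close> be the
  Abel transform, which maps \<open>h\<close> to the integral of \<open>h (p + t\<^sup>2)\<close> over \<open>t\<close>.
  Splitting \<open>K p t = K p 0 + (K p t - K p 0)\<close> and integrating the second term by parts gives
  \<open>\<bar>K p 0\<bar> * \<bar>A b p\<bar> \<le> C * A \<bar>G\<bar> p\<close>. Two Abel transforms amount, in polar coordinates of the plane,
  to one plain integration: \<open>A (A b) = (pi / 4) * G\<close> (lemma \<open>abel_abel\<close>). Since \<open>K p 0\<close> vanishes
  at most to first order, \<open>\<bar>K p 0\<bar> \<ge> c * (B - p)\<close> just below \<open>B\<close>. Altogether
  \<open>\<bar>G p\<bar>\<close> is at most a constant times the integral of \<open>\<bar>G q\<bar> / (B - q)\<close> over \<open>q \<in> {p..B}\<close>.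
  This inequality alone admits powers of \<open>B - p\<close> as solutions, but a bound
  \<open>\<bar>G q\<bar> \<le> M * (B - q) ^ N\<close> improves to the same bound with \<open>M * C / (c * N)\<close> in place of \<open>M\<close>.
  Because \<open>a\<close> is smooth and vanishes beyond \<open>sqrt B\<close>, such bounds hold for every \<open>N\<close>; taking
  \<open>N\<close> large and iterating gives \<open>G = 0\<close> just below \<open>B\<close>
  (lemma \<open>generalized_abel_local_uniqueness\<close>). Hence the infimum of the admissible \<open>B\<close> is zero
  and every \<open>a\<close> vanishes (lemma \<open>circle_moment_eq_0\<close>). By Stone--Weierstrass, trigonometric polynomials
  are dense among the continuous functions on each circle, so \<open>f = 0\<close>.
\<close>

section \<open>The Abel transform in the squared radius\<close>

text \<open>
  The usual Abel transform integrates a radial function over a line at distance \<open>s\<close> from the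
  origin. Here \<open>h\<close> is a function of the squared radius and \<open>p = s\<^sup>2\<close>, so that the singular weight of
  the classical formula disappears. The cut-off \<open>L\<close> changes nothing for \<open>p \<ge> 0\<close> and \<open>h\<close> vanishing
  beyond \<open>L\<^sup>2\<close>.
\<close>

definition abel :: "real \<Rightarrow> (real \<Rightarrow> real) \<Rightarrow> real \<Rightarrow> real" where
  "abel L h p = integral {0..L} (\<lambda>t. h (p + t\<^sup>2))"

lemma integrable_abel:
  fixes h :: "real \<Rightarrow> real"
  assumes "continuous_on UNIV h"
  shows "(\<lambda>t. h (p + t\<^sup>2)) integrable_on {a..b}"
  by (intro integrable_continuous_interval continuous_on_compose2[OF assms] continuous_intros) auto

lemma continuous_on_abel:
  assumes "continuous_on UNIV h"
  shows "continuous_on UNIV (abel L h)"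
proof -
  have "continuous_on (UNIV \<times> cbox 0 L) (\<lambda>(p, t). h (p + t\<^sup>2))"
    unfolding case_prod_beta
    by (intro continuous_on_compose2[OF assms] continuous_intros) auto
  from integral_continuous_on_param[OF this] show ?thesis
    unfolding abel_def by simp
qed

lemma nn_integral_abel:
  assumes cont: "continuous_on UNIV h" and nonneg: "\<And>q. 0 \<le> h q"
    and vanish: "\<And>q. L\<^sup>2 \<le> q \<Longrightarrow> h q = 0" and "0 \<le> p" "0 \<le> L"
  shows "ennreal (abel L h p) = (\<integral>\<^sup>+t. ennreal (h (p + t\<^sup>2)) * indicator {0..} t \<partial>lborel)"
proof -
  have "((\<lambda>t. h (p + t\<^sup>2)) has_integral abel L h p) {0..L}"
    unfolding abel_def using integrable_abel[OF cont] by blast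
  then have "ennreal (abel L h p) = (\<integral>\<^sup>+t. ennreal (h (p + t\<^sup>2)) * indicator {0..L} t \<partial>lborel)"
    using nn_integral_has_integral_lebesgue'[of "{0..L}" "\<lambda>t. h (p + t\<^sup>2)"] nonneg by simp
  also have "\<dots> = (\<integral>\<^sup>+t. ennreal (h (p + t\<^sup>2)) * indicator {0..} t \<partial>lborel)"
  proof (rule nn_integral_cong)
    fix t :: real
    have "h (p + t\<^sup>2) = 0" if "L < t"
      using that \<open>0 \<le> p\<close> \<open>0 \<le> L\<close> by (intro vanish add_increasing power_mono) auto
    then show "ennreal (h (p + t\<^sup>2)) * indicator {0..L} t = ennreal (h (p + t\<^sup>2)) * indicator {0..} t"
      by (cases "L < t") (auto simp: indicator_def)
  qed
  finally show ?thesis .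
qed

text \<open>
  The iterated transform is the integral of \<open>h (p + u\<^sup>2 + t\<^sup>2)\<close> over a quarter plane. The substitution
  \<open>t = u * y\<close> plays the role of polar coordinates, \<open>y\<close> being the tangent of the polar angle: after
  exchanging the integrals, the one over \<open>u\<close> gives \<open>G p / (2 * (1 + y\<^sup>2))\<close> and the one over \<open>y\<close> gives
  \<open>arctan\<close> at infinity. Nonnegativity allows the exchange without any integrability check.
\<close>

lemma abel_abel_nonneg:
  fixes h G :: "real \<Rightarrow> real"
  assumes cont: "continuous_on UNIV h" and nonneg: "\<And>q. 0 \<le> h q"
    and vanish: "\<And>q. L\<^sup>2 \<le> q \<Longrightarrow> h q = 0" and "0 \<le> p" "0 \<le> L"
    and der: "\<And>q. (G has_real_derivative - h q) (at q)"
    and G0: "\<And>q. L\<^sup>2 \<le> q \<Longrightarrow> G q = 0"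
  shows "abel L (abel L h) p = pi / 4 * G p"
proof -
  have [measurable]: "h \<in> borel_measurable borel"
    using cont by (rule borel_measurable_continuous_onI)
  have Gp: "G p \<ge> 0"
  proof -
    have "G (max p (L\<^sup>2)) \<le> G p"
    proof (rule DERIV_nonpos_imp_nonincreasing[where f = G])
      show "\<exists>y. (G has_real_derivative y) (at q) \<and> y \<le> 0" for q
        using der[of q] nonneg[of q] by (intro exI[of _ "- h q"]) auto
    qed simp
    then show ?thesis using G0[of "max p (L\<^sup>2)"] by simp
  qed
  have abel_nonneg: "0 \<le> abel L h q" for q
    unfolding abel_def by (rule integral_nonneg) (use integrable_abel[OF cont] nonneg in auto)
  have abel_vanish: "abel L h q = 0" if "L\<^sup>2 \<le> q" for q
  proof -
    have "abel L h q = integral {0..L} (\<lambda>t. 0)"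
      unfolding abel_def by (rule integral_cong) (use that in \<open>auto intro!: vanish add_increasing2\<close>)
    then show ?thesis by simp
  qed
  have radial: "(\<integral>\<^sup>+u. ennreal (u * h (p + u\<^sup>2 * (1 + y\<^sup>2))) * indicator {0..} u \<partial>lborel)
      = ennreal (G p / 2 * (1 / (1 + y\<^sup>2)))" for y :: real
  proof -
    have y: "1 + y\<^sup>2 > 0" by (simp add: add_pos_nonneg)
    have "(\<integral>\<^sup>+u. ennreal (u * h (p + u\<^sup>2 * (1 + y\<^sup>2))) * indicator {0..} u \<partial>lborel)
        = 0 - (- G (p + 0\<^sup>2 * (1 + y\<^sup>2)) / (2 * (1 + y\<^sup>2)))"
    proof (rule nn_integral_FTC_atLeast)
      show "((\<lambda>u. - G (p + u\<^sup>2 * (1 + y\<^sup>2)) / (2 * (1 + y\<^sup>2))) has_real_derivative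
          u * h (p + u\<^sup>2 * (1 + y\<^sup>2))) (at u)" for u
      proof -
        have "((\<lambda>u. p + u\<^sup>2 * (1 + y\<^sup>2)) has_real_derivative 2 * u * (1 + y\<^sup>2)) (at u)"
          by (auto intro!: derivative_eq_intros)
        from DERIV_cdivide[OF DERIV_minus[OF DERIV_chain2[OF der this]], of "2 * (1 + y\<^sup>2)"]
        show ?thesis
          by (rule DERIV_cong) (use y in \<open>simp add: divide_eq_eq\<close>)
      qed
      show "((\<lambda>u. - G (p + u\<^sup>2 * (1 + y\<^sup>2)) / (2 * (1 + y\<^sup>2))) \<longlongrightarrow> 0) at_top"
      proof (rule tendsto_eventually)
        have "- G (p + u\<^sup>2 * (1 + y\<^sup>2)) / (2 * (1 + y\<^sup>2)) = 0" if "L \<le> u" for u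
        proof -
          have "L\<^sup>2 \<le> u\<^sup>2" using that \<open>0 \<le> L\<close> by (intro power_mono) auto
          also have "u\<^sup>2 * 1 \<le> u\<^sup>2 * (1 + y\<^sup>2)" by (intro mult_left_mono) auto
          finally show ?thesis using \<open>0 \<le> p\<close> by (simp add: G0)
        qed
        then show "\<forall>\<^sub>F u in at_top. - G (p + u\<^sup>2 * (1 + y\<^sup>2)) / (2 * (1 + y\<^sup>2)) = 0"
          using eventually_at_top_linorder by blast
      qed
    qed (use nonneg in auto)
    then show ?thesis by simp
  qed
  have angular: "(\<integral>\<^sup>+y. ennreal (G p / 2 * (1 / (1 + y\<^sup>2))) * indicator {0..} y \<partial>lborel)
      = ennreal (pi / 4 * G p)"
  proof -
    have "(\<integral>\<^sup>+y. ennreal (G p / 2 * (1 / (1 + y\<^sup>2))) * indicator {0..} y \<partial>lborel)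
      = ennreal (G p / 2 * (pi / 2) - (\<lambda>y. G p / 2 * arctan y) 0)"
    proof (rule nn_integral_FTC_atLeast)
      show "((\<lambda>y. G p / 2 * arctan y) has_real_derivative G p / 2 * (1 / (1 + y\<^sup>2))) (at y)" for y
        using DERIV_cmult[OF DERIV_arctan[of y], of "G p / 2"] by (simp only: inverse_eq_divide)
      show "((\<lambda>y. G p / 2 * arctan y) \<longlongrightarrow> G p / 2 * (pi / 2)) at_top"
        by (intro tendsto_mult tendsto_arctan_at_top tendsto_const)
      show "0 \<le> G p / 2 * (1 / (1 + y\<^sup>2))" for y
        using Gp by (intro mult_nonneg_nonneg) (auto intro: add_nonneg_nonneg)
    qed measurable
    then show ?thesis by (simp add: mult.commute)
  qed
  have scale: "(\<integral>\<^sup>+t. ennreal (h (p + u\<^sup>2 + t\<^sup>2)) * indicator {0..} t \<partial>lborel)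
      = (\<integral>\<^sup>+y. ennreal (u * h (p + u\<^sup>2 * (1 + y\<^sup>2))) * indicator {0..} y \<partial>lborel)" if "u > 0" for u :: real
  proof -
    have "(\<integral>\<^sup>+t. ennreal (h (p + u\<^sup>2 + t\<^sup>2)) * indicator {0..} t \<partial>lborel)
       = \<bar>u\<bar> * (\<integral>\<^sup>+y. ennreal (h (p + u\<^sup>2 + (0 + u * y)\<^sup>2)) * indicator {0..} (0 + u * y) \<partial>lborel)"
      using that by (intro nn_integral_real_affine) auto
    also have "\<dots> = (\<integral>\<^sup>+y. \<bar>u\<bar> * (ennreal (h (p + u\<^sup>2 + (0 + u * y)\<^sup>2)) * indicator {0..} (0 + u * y)) \<partial>lborel)"
      by (rule nn_integral_cmult[symmetric]) measurable
    also have "\<dots> = (\<integral>\<^sup>+y. ennreal (u * h (p + u\<^sup>2 * (1 + y\<^sup>2))) * indicator {0..} y \<partial>lborel)"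
      using that nonneg
      by (intro nn_integral_cong)
         (auto simp: indicator_def zero_le_mult_iff ennreal_mult' power_mult_distrib algebra_simps)
    finally show ?thesis .
  qed
  have "ennreal (abel L (abel L h) p)
      = (\<integral>\<^sup>+u. ennreal (abel L h (p + u\<^sup>2)) * indicator {0..} u \<partial>lborel)"
    using continuous_on_abel[OF cont] abel_nonneg abel_vanish \<open>0 \<le> p\<close> \<open>0 \<le> L\<close>
    by (rule nn_integral_abel)
  also have "\<dots> = (\<integral>\<^sup>+u. (\<integral>\<^sup>+y. ennreal (u * h (p + u\<^sup>2 * (1 + y\<^sup>2))) * indicator {0..} y
      * indicator {0..} u \<partial>lborel) \<partial>lborel)"
  proof (rule nn_integral_cong_AE)
    show "AE u in lborel. ennreal (abel L h (p + u\<^sup>2)) * indicator {0..} u =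
        (\<integral>\<^sup>+y. ennreal (u * h (p + u\<^sup>2 * (1 + y\<^sup>2))) * indicator {0..} y * indicator {0..} u \<partial>lborel)"
      using AE_lborel_singleton[of "0::real"]
    proof eventually_elim
      case (elim u)
      show ?case
      proof (cases "u > 0")
        case True
        then have "ennreal (abel L h (p + u\<^sup>2)) =
            (\<integral>\<^sup>+t. ennreal (h (p + u\<^sup>2 + t\<^sup>2)) * indicator {0..} t \<partial>lborel)"
          using \<open>0 \<le> p\<close> by (intro nn_integral_abel cont nonneg vanish \<open>0 \<le> L\<close>) auto
        with True scale[OF True] show ?thesis by simp
      qed (use elim in \<open>simp add: indicator_def\<close>)
    qed
  qed
  also have "\<dots> = (\<integral>\<^sup>+y. (\<integral>\<^sup>+u. ennreal (u * h (p + u\<^sup>2 * (1 + y\<^sup>2))) * indicator {0..} y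
      * indicator {0..} u \<partial>lborel) \<partial>lborel)"
    by (rule lborel_pair.Fubini') measurable
  also have "\<dots> = (\<integral>\<^sup>+y. (\<integral>\<^sup>+u. ennreal (u * h (p + u\<^sup>2 * (1 + y\<^sup>2))) * indicator {0..} u \<partial>lborel)
      * indicator {0..} y \<partial>lborel)"
    by (intro nn_integral_cong) (simp add: indicator_def)
  also have "\<dots> = (\<integral>\<^sup>+y. ennreal (G p / 2 * (1 / (1 + y\<^sup>2))) * indicator {0..} y \<partial>lborel)"
    by (simp only: radial)
  also have "\<dots> = ennreal (pi / 4 * G p)"
    by (rule angular)
  finally have "ennreal (abel L (abel L h) p) = ennreal (pi / 4 * G p)" .
  moreover have "0 \<le> abel L (abel L h) p"
    unfolding abel_def[of L "abel L h"]
    by (rule integral_nonneg) (use integrable_abel[OF continuous_on_abel[OF cont]] abel_nonneg in auto)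
  ultimately show ?thesis using Gp by (simp add: ennreal_inj)
qed

lemma antiderivative_UNIV:
  fixes h :: "real \<Rightarrow> real"
  assumes "continuous_on UNIV h"
  obtains G where "\<And>q. (G has_real_derivative - h q) (at q)" "G B = 0"
proof -
  have "\<exists>F. \<forall>x::real. -\<infinity> < ereal x \<longrightarrow> ereal x < \<infinity> \<longrightarrow> (F has_vector_derivative - h x) (at x)"
    using assms by (intro einterval_antiderivative) (auto simp: continuous_on_eq_continuous_at)
  then obtain F where F: "\<And>x. (F has_vector_derivative - h x) (at x)" by auto
  show ?thesis
  proof
    show "((\<lambda>q. F q - F B) has_real_derivative - h q) (at q)" for q
      using F[of q] unfolding has_real_derivative_iff_has_vector_derivative[symmetric]
      by (auto intro!: derivative_eq_intros)
  qed simp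
qed

lemma vanish_of_derivative_zero:
  fixes G :: "real \<Rightarrow> real"
  assumes der: "\<And>q. (G has_real_derivative g q) (at q)" and "\<And>q. B \<le> q \<Longrightarrow> g q = 0" and "G B = 0"
    and "B \<le> q"
  shows "G q = 0"
proof (cases "q = B")
  case False
  with \<open>B \<le> q\<close> have "B < q" by simp
  obtain z where "B < z" "z < q" "G q - G B = (q - B) * g z"
    using MVT2[OF \<open>B < q\<close>, of G g] der by blast
  with assms show ?thesis by simp
qed (use assms in simp)

lemma abel_abel:
  fixes h G :: "real \<Rightarrow> real"
  assumes cont: "continuous_on UNIV h"
    and vanish: "\<And>q. L\<^sup>2 \<le> q \<Longrightarrow> h q = 0" and "0 \<le> p" "0 \<le> L"
    and der: "\<And>q. (G has_real_derivative - h q) (at q)"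
    and G0: "G (L\<^sup>2) = 0"
  shows "abel L (abel L h) p = pi / 4 * G p"
proof -
  \<comment> \<open>The polar-coordinate argument is available for nonnegative functions, hence the splitting.\<close>
  define hp where "hp q = max 0 (h q)" for q
  define hn where "hn q = max 0 (- h q)" for q
  have cp: "continuous_on UNIV hp" and cn: "continuous_on UNIV hn"
    unfolding hp_def hn_def by (intro continuous_intros cont)+
  obtain Gp where Gp: "\<And>q. (Gp has_real_derivative - hp q) (at q)" "Gp (L\<^sup>2) = 0"
    using antiderivative_UNIV[OF cp] by blast
  obtain Gn where Gn: "\<And>q. (Gn has_real_derivative - hn q) (at q)" "Gn (L\<^sup>2) = 0"
    using antiderivative_UNIV[OF cn] by blast
  have h: "h = (\<lambda>q. hp q - hn q)" by (auto simp: hp_def hn_def)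
  have lin: "abel L (\<lambda>q. f q - g q) = (\<lambda>q. abel L f q - abel L g q)"
    if "continuous_on UNIV f" "continuous_on UNIV g" for f g
    unfolding abel_def by (intro ext integral_diff integrable_abel that)
  have vp: "hp q = 0" and vn: "hn q = 0" if "L\<^sup>2 \<le> q" for q
    using vanish[OF that] by (auto simp: hp_def hn_def)
  have AA: "abel L (abel L hp) p = pi / 4 * Gp p" "abel L (abel L hn) p = pi / 4 * Gn p"
  proof -
    have "Gp q = 0" "Gn q = 0" if "L\<^sup>2 \<le> q" for q
      using vanish_of_derivative_zero[OF Gp(1) _ Gp(2) that] vp
        vanish_of_derivative_zero[OF Gn(1) _ Gn(2) that] vn by simp_all
    moreover have "0 \<le> hp q" "0 \<le> hn q" for q by (simp_all add: hp_def hn_def)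
    ultimately show "abel L (abel L hp) p = pi / 4 * Gp p" "abel L (abel L hn) p = pi / 4 * Gn p"
      using \<open>0 \<le> p\<close> \<open>0 \<le> L\<close> vp vn Gp(1) Gn(1) cp cn abel_abel_nonneg by blast+
  qed
  have "\<forall>q. ((\<lambda>q. G q - (Gp q - Gn q)) has_real_derivative 0) (at q)"
  proof
    fix q
    have "((\<lambda>q. G q - (Gp q - Gn q)) has_real_derivative - h q - (- hp q - - hn q)) (at q)"
      by (intro DERIV_diff der Gp Gn)
    then show "((\<lambda>q. G q - (Gp q - Gn q)) has_real_derivative 0) (at q)"
      by (simp add: h)
  qed
  from DERIV_isconst_all[OF this, of p "L\<^sup>2"] have G: "G p = Gp p - Gn p"
    using Gp(2) Gn(2) G0 by simp
  have "abel L (abel L h) p = abel L (abel L hp) p - abel L (abel L hn) p"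
    unfolding h lin[OF cp cn] lin[OF continuous_on_abel[OF cp] continuous_on_abel[OF cn]] ..
  then show ?thesis
    unfolding AA G by (simp add: algebra_simps)
qed

section \<open>Local uniqueness for generalized Abel equations\<close>

text \<open>
  Since \<open>k' t = O(t)\<close>, the quotient \<open>(k t - k 0) / (2 * t)\<close> is bounded near \<open>t = 0\<close> and its
  derivative is at most \<open>C\<close>, although \<open>b (p + t\<^sup>2)\<close> is \<open>- 1 / (2 * t)\<close> times the derivative of
  \<open>G (p + t\<^sup>2)\<close>. Integrating by parts therefore replaces \<open>b\<close> by its antiderivative \<open>G\<close> without
  creating a singularity at \<open>t = 0\<close>; the boundary terms vanish.
\<close>

lemma integration_by_parts_flat_kernel:
  fixes b G k k' :: "real \<Rightarrow> real"
  assumes cont: "continuous_on UNIV b"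
    and derG: "\<And>q. (G has_real_derivative - b q) (at q)" and GL: "G (p + L\<^sup>2) = 0"
    and derk: "\<And>t. (k has_real_derivative k' t) (at t)"
    and k': "\<And>t. 0 \<le> t \<Longrightarrow> t \<le> L \<Longrightarrow> \<bar>k' t\<bar> \<le> C * t" and "0 < L"
  shows "\<bar>integral {0..L} (\<lambda>t. b (p + t\<^sup>2) * (k t - k 0))\<bar> \<le> C * integral {0..L} (\<lambda>t. \<bar>G (p + t\<^sup>2)\<bar>)"
proof -
  \<comment> \<open>At \<open>t = 0\<close> both quotients have the value zero, which is the right limit for \<open>m\<close>.\<close>
  define m where "m t = (k t - k 0) / (2 * t)" for t
  define m' where "m' t = (k' t * (2 * t) - (k t - k 0) * 2) / (2 * t)\<^sup>2" for t
  define W where "W t = - G (p + t\<^sup>2) * m t" for t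
  have "C \<ge> 0"
    using k'[of L] \<open>0 < L\<close> by (smt (verit) zero_le_mult_iff)
  have contG: "continuous_on UNIV G"
    using derG by (auto intro!: continuous_at_imp_continuous_on DERIV_isCont)
  have contk: "continuous_on UNIV k"
    using derk by (auto intro!: continuous_at_imp_continuous_on DERIV_isCont)
  have k_bound: "\<bar>k t - k 0\<bar> \<le> C * t\<^sup>2" if "0 \<le> t" "t \<le> L" for t
  proof (cases "t = 0")
    case False
    with that have "0 < t" by simp
    obtain z where z: "0 < z" "z < t" "k t - k 0 = (t - 0) * k' z"
      using MVT2[OF \<open>0 < t\<close>, of k k'] derk by blast
    have "\<bar>k' z\<bar> \<le> C * z" using z that by (intro k') auto
    also have "\<dots> \<le> C * t" using z \<open>C \<ge> 0\<close> by (intro mult_left_mono) auto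
    finally have "t * \<bar>k' z\<bar> \<le> t * (C * t)" using that by (intro mult_left_mono) auto
    then show ?thesis using z that by (simp add: abs_mult power2_eq_square mult_ac)
  qed simp
  have m_bound: "\<bar>m t\<bar> \<le> C * t / 2" if "0 \<le> t" "t \<le> L" for t
  proof (cases "t = 0")
    case False
    then show ?thesis
      using k_bound[OF that] that by (simp add: m_def field_simps power2_eq_square)
  qed (simp add: m_def)
  have m'_bound: "\<bar>m' t\<bar> \<le> C" if "0 \<le> t" "t \<le> L" for t
  proof (cases "t = 0")
    case False
    have "\<bar>k' t * (2 * t) - (k t - k 0) * 2\<bar> \<le> \<bar>k' t\<bar> * (2 * t) + \<bar>k t - k 0\<bar> * 2"
      by (rule order_trans[OF abs_triangle_ineq4])
         (use that in \<open>simp add: abs_mult del: left_diff_distrib_numeral\<close>)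
    also have "\<dots> \<le> (C * t) * (2 * t) + (C * t\<^sup>2) * 2"
      using k'[OF that] k_bound[OF that] that by (intro add_mono mult_right_mono) auto
    also have "\<dots> = C * (2 * t)\<^sup>2" by (simp add: power2_eq_square)
    finally show ?thesis
      using False unfolding m'_def abs_divide by (simp add: pos_divide_le_eq)
  qed (simp add: m'_def \<open>C \<ge> 0\<close>)
  have derm: "(m has_real_derivative m' t) (at t)" if "0 < t" for t
    unfolding m_def[abs_def] m'_def power2_eq_square using that
    by (auto intro!: derivative_eq_intros derk)
  have derG2: "((\<lambda>t. G (p + t\<^sup>2)) has_real_derivative - b (p + t\<^sup>2) * (2 * t)) (at t)" for t
    by (rule DERIV_chain2[OF derG]) (auto intro!: derivative_eq_intros)
  have derW: "(W has_real_derivative b (p + t\<^sup>2) * (k t - k 0) - G (p + t\<^sup>2) * m' t) (at t)"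
    if "0 < t" for t
  proof -
    have "(2 * t) * m t = k t - k 0" using that by (simp add: m_def)
    then have "b (p + t\<^sup>2) * (k t - k 0) = b (p + t\<^sup>2) * (2 * t) * m t"
      by (simp only: mult.assoc)
    then show ?thesis
      using DERIV_mult[OF DERIV_minus[OF derG2[of t]] derm[OF that]]
      unfolding W_def[abs_def] by (simp add: algebra_simps)
  qed
  have contm: "continuous_on {0..L} m"
  proof (rule continuous_on_eq_continuous_within[THEN iffD2], rule ballI)
    fix t assume t: "t \<in> {0..L}"
    show "continuous (at t within {0..L}) m"
    proof (cases "t = 0")
      case True
      have "(m \<longlongrightarrow> 0) (at 0 within {0..L})"
      proof (rule Lim_null_comparison)
        show "\<forall>\<^sub>F t in at 0 within {0..L}. norm (m t) \<le> C * t / 2"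
          using m_bound by (auto simp: eventually_at_filter)
        show "((\<lambda>t. C * t / 2) \<longlongrightarrow> 0) (at 0 within {0..L})"
          by (auto intro!: tendsto_eq_intros)
      qed
      then show ?thesis
        using True by (simp add: continuous_within m_def)
    next
      case False
      then show ?thesis
        using t derm[of t] DERIV_isCont continuous_at_imp_continuous_at_within by fastforce
    qed
  qed
  have "((\<lambda>t. b (p + t\<^sup>2) * (k t - k 0) - G (p + t\<^sup>2) * m' t) has_integral W L - W 0) {0..L}"
  proof (rule fundamental_theorem_of_calculus_interior)
    show "continuous_on {0..L} W"
      unfolding W_def[abs_def]
      by (intro continuous_intros contm continuous_on_compose2[OF contG]) auto
  qed (use derW \<open>0 < L\<close> in \<open>auto simp: has_real_derivative_iff_has_vector_derivative[symmetric]\<close>)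
  moreover have "W L - W 0 = 0" using GL by (simp add: W_def m_def)
  ultimately have W: "((\<lambda>t. b (p + t\<^sup>2) * (k t - k 0) - G (p + t\<^sup>2) * m' t) has_integral 0) {0..L}"
    by simp
  have "(\<lambda>t. b (p + t\<^sup>2) * (k t - k 0)) integrable_on {0..L}"
    by (intro integrable_continuous_interval continuous_intros
          continuous_on_compose2[OF cont] continuous_on_subset[OF contk]) auto
  then have "((\<lambda>t. G (p + t\<^sup>2) * m' t) has_integral
      integral {0..L} (\<lambda>t. b (p + t\<^sup>2) * (k t - k 0))) {0..L}"
    using has_integral_diff[OF integrable_integral W] by fastforce
  then have I: "integral {0..L} (\<lambda>t. G (p + t\<^sup>2) * m' t)
      = integral {0..L} (\<lambda>t. b (p + t\<^sup>2) * (k t - k 0))"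
    and int: "(\<lambda>t. G (p + t\<^sup>2) * m' t) integrable_on {0..L}"
    by (auto simp: integral_unique)
  have "norm (integral {0..L} (\<lambda>t. G (p + t\<^sup>2) * m' t)) \<le> integral {0..L} (\<lambda>t. C * \<bar>G (p + t\<^sup>2)\<bar>)"
  proof (rule integral_norm_bound_integral[OF int])
    show "(\<lambda>t. C * \<bar>G (p + t\<^sup>2)\<bar>) integrable_on {0..L}"
      by (intro integrable_continuous_interval continuous_intros continuous_on_compose2[OF contG]) auto
    show "norm (G (p + t\<^sup>2) * m' t) \<le> C * \<bar>G (p + t\<^sup>2)\<bar>" if "t \<in> {0..L}" for t
      using mult_right_mono[OF m'_bound[of t], of "\<bar>G (p + t\<^sup>2)\<bar>"] that
      by (simp add: abs_mult mult.commute)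
  qed
  then show ?thesis by (simp add: I)
qed

text \<open>
  The descent treats regular points and simple zeros of the diagonal of the kernel alike: it uses
  only this one-sided estimate.
\<close>

lemma linear_lower_bound_at_simple_zero:
  fixes g :: "real \<Rightarrow> real"
  assumes der: "(g has_real_derivative D) (at B)" and "g B \<noteq> 0 \<or> D \<noteq> 0"
  shows "\<exists>c \<delta>. 0 < c \<and> 0 < \<delta> \<and> (\<forall>p. B - \<delta> < p \<and> p < B \<longrightarrow> c * (B - p) \<le> \<bar>g p\<bar>)"
proof (cases "g B = 0")
  case True
  with assms have "D \<noteq> 0" by simp
  have "((\<lambda>p. (g p - g B) / (p - B)) \<longlongrightarrow> D) (at B)"
    using der by (simp add: has_field_derivative_iff)
  from tendstoD[OF this, of "\<bar>D\<bar> / 2"] \<open>D \<noteq> 0\<close>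
  obtain \<delta> where \<delta>: "0 < \<delta>"
    "\<And>p. p \<noteq> B \<Longrightarrow> dist p B < \<delta> \<Longrightarrow> dist ((g p - g B) / (p - B)) D < \<bar>D\<bar> / 2"
    by (auto simp: eventually_at)
  show ?thesis
  proof (rule exI[of _ "\<bar>D\<bar> / 2"], rule exI[of _ \<delta>], intro conjI allI impI)
    fix p assume p: "B - \<delta> < p \<and> p < B"
    then have "\<bar>g p / (p - B) - D\<bar> < \<bar>D\<bar> / 2"
      using \<delta>(2)[of p] True by (simp add: dist_real_def)
    then have "\<bar>D\<bar> / 2 \<le> \<bar>g p / (p - B)\<bar>" by linarith
    then show "\<bar>D\<bar> / 2 * (B - p) \<le> \<bar>g p\<bar>"
      using p by (simp add: abs_divide pos_le_divide_eq)
  qed (use \<delta> \<open>D \<noteq> 0\<close> in auto)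
next
  case False
  have "(g \<longlongrightarrow> g B) (at B)"
    using DERIV_isCont[OF der] by (simp add: isCont_def)
  from tendstoD[OF this, of "\<bar>g B\<bar> / 2"] False
  obtain \<delta> where \<delta>: "0 < \<delta>"
    "\<And>p. p \<noteq> B \<Longrightarrow> dist p B < \<delta> \<Longrightarrow> dist (g p) (g B) < \<bar>g B\<bar> / 2"
    by (auto simp: eventually_at)
  show ?thesis
  proof (rule exI[of _ "\<bar>g B\<bar> / 2"], rule exI[of _ "min \<delta> 1"], intro conjI allI impI)
    fix p assume p: "B - min \<delta> 1 < p \<and> p < B"
    then have "\<bar>g p - g B\<bar> < \<bar>g B\<bar> / 2"
      using \<delta>(2)[of p] by (auto simp: dist_real_def)
    then have "\<bar>g B\<bar> / 2 \<le> \<bar>g p\<bar>" by linarith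
    moreover have "\<bar>g B\<bar> / 2 * (B - p) \<le> \<bar>g B\<bar> / 2 * 1"
      using p by (intro mult_left_mono) auto
    ultimately show "\<bar>g B\<bar> / 2 * (B - p) \<le> \<bar>g p\<bar>" by simp
  qed (use \<delta> False in auto)
qed

text \<open>
  Truncated powers are the comparison functions of the descent argument: the factor
  \<open>1 / Suc n\<close> on the right is what makes that argument contract for large \<open>n\<close>.
\<close>

lemma abel_power:
  assumes "1 \<le> n" "B \<le> L\<^sup>2" "0 \<le> p" "p \<le> B" "0 \<le> L"
  shows "abel L (abel L (\<lambda>q. max 0 (B - q) ^ n)) p = pi / 4 * ((B - p) ^ Suc n / Suc n)"
proof -
  let ?H = "\<lambda>q. max 0 (B - q) ^ n"
  have cont: "continuous_on UNIV ?H" by (intro continuous_intros)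
  obtain G where G: "\<And>q. (G has_real_derivative - ?H q) (at q)" "G B = 0"
    using antiderivative_UNIV[OF cont, of B] by blast
  have vanish: "?H q = 0" if "B \<le> q" for q
    using that \<open>1 \<le> n\<close> by (simp add: max_def power_0_left)
  have "abel L (abel L ?H) p = pi / 4 * G p"
  proof (rule abel_abel[OF cont])
    show "G (L\<^sup>2) = 0"
      using vanish_of_derivative_zero[OF G(1) _ G(2)] vanish \<open>B \<le> L\<^sup>2\<close> by simp
  qed (use assms G(1) vanish in auto)
  also have "G p = (B - p) ^ Suc n / Suc n"
  proof (cases "p = B")
    case False
    let ?D = "\<lambda>q. G q - (B - q) ^ Suc n / Suc n"
    have "?D B = ?D p"
    proof (rule DERIV_isconst_end[where f = ?D])
      show "p < B" using False \<open>p \<le> B\<close> by simp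
      have "continuous_on {p..B} G"
        using G(1) by (auto intro!: continuous_at_imp_continuous_on DERIV_isCont)
      then show "continuous_on {p..B} ?D" by (intro continuous_intros) auto
      show "(?D has_real_derivative 0) (at q)" if "p < q" "q < B" for q
      proof -
        have "((\<lambda>q. (B - q) ^ Suc n) has_real_derivative - (Suc n * (B - q) ^ n)) (at q)"
        proof -
          have "((\<lambda>q. B - q) has_real_derivative -1) (at q)"
            by (auto intro!: derivative_eq_intros)
          from DERIV_power_Suc[OF this, of n] show ?thesis by simp
        qed
        from DERIV_cdivide[OF this, of "Suc n"]
        have "((\<lambda>q. (B - q) ^ Suc n / Suc n) has_real_derivative - ((B - q) ^ n)) (at q)"
          by (simp del: of_nat_Suc power_Suc)
        from DERIV_diff[OF G(1) this] that show ?thesis by (simp add: max_def)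
      qed
    qed
    then show ?thesis using G(2) by simp
  qed (use G in simp)
  finally show ?thesis .
qed

text \<open>
  Improvement of a power bound on \<open>G\<close>. For \<open>q < B\<close>, integration by parts bounds
  \<open>\<bar>K q 0\<bar> * \<bar>abel L b q\<bar>\<close> by \<open>C\<close> times the Abel transform of \<open>\<bar>G\<bar>\<close>. One factor \<open>B - q\<close> of the assumed
  bound compensates the possible zero of \<open>K q 0\<close> at \<open>B\<close>, and \<open>abel_power\<close> evaluates the second Abel
  transform of the remaining \<open>n\<close>-th power.
\<close>

lemma generalized_abel_contraction:
  fixes b G :: "real \<Rightarrow> real" and K K' :: "real \<Rightarrow> real \<Rightarrow> real"
  assumes "0 < L" "B \<le> L\<^sup>2" "0 \<le> p1" and cont: "continuous_on UNIV b"
    and vanish: "\<And>q. B \<le> q \<Longrightarrow> b q = 0"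
    and derG: "\<And>q. (G has_real_derivative - b q) (at q)" and GB: "G B = 0"
    and derK: "\<And>p t. p1 \<le> p \<Longrightarrow> p < B \<Longrightarrow> (K p has_real_derivative K' p t) (at t)"
    and K': "\<And>p t. p1 \<le> p \<Longrightarrow> p < B \<Longrightarrow> 0 \<le> t \<Longrightarrow> t \<le> L \<Longrightarrow> \<bar>K' p t\<bar> \<le> C * t"
    and eq: "\<And>p. p1 \<le> p \<Longrightarrow> p < B \<Longrightarrow> integral {0..L} (\<lambda>t. b (p + t\<^sup>2) * K p t) = 0"
    and "0 < c" and diag: "\<And>p. p1 \<le> p \<Longrightarrow> p < B \<Longrightarrow> c * (B - p) \<le> \<bar>K p 0\<bar>"
    and "1 \<le> n" "0 \<le> C" "0 \<le> M"
    and flat: "\<And>q. p1 \<le> q \<Longrightarrow> q \<le> B \<Longrightarrow> \<bar>G q\<bar> \<le> M * (B - q) ^ Suc n"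
    and p: "p1 \<le> p" "p \<le> B"
  shows "\<bar>G p\<bar> \<le> C / c * M / Suc n * (B - p) ^ Suc n"
proof -
  let ?H = "\<lambda>q. max 0 (B - q) ^ n"
  have contH: "continuous_on UNIV ?H" by (intro continuous_intros)
  have contG: "continuous_on UNIV G"
    using derG by (auto intro!: continuous_at_imp_continuous_on DERIV_isCont)
  have G0: "G q = 0" if "B \<le> q" for q
    using vanish_of_derivative_zero[OF derG _ GB that] vanish by simp
  have abelH: "0 \<le> abel L ?H q" for q
    unfolding abel_def by (rule integral_nonneg[OF integrable_abel[OF contH]]) simp
  have abel_bound: "\<bar>abel L b q\<bar> \<le> C / c * M * abel L ?H q" if "p1 \<le> q" for q
  proof (cases "q < B")
    case False
    have "abel L b q = integral {0..L} (\<lambda>t. 0)"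
      unfolding abel_def
      by (rule integral_cong) (use False in \<open>auto intro!: vanish add_increasing2\<close>)
    then show ?thesis using abelH \<open>0 \<le> C\<close> \<open>0 \<le> M\<close> \<open>0 < c\<close> by simp
  next
    case True
    note q = that True
    have contK: "continuous_on {0..L} (K q)"
      using derK[OF q] by (auto intro!: continuous_at_imp_continuous_on DERIV_isCont)
    have int1: "(\<lambda>t. b (q + t\<^sup>2) * K q t) integrable_on {0..L}"
      by (intro integrable_continuous_interval continuous_intros
            continuous_on_compose2[OF cont] contK) auto
    have int2: "(\<lambda>t. b (q + t\<^sup>2) * K q 0) integrable_on {0..L}"
      by (intro integrable_continuous_interval continuous_intros
            continuous_on_compose2[OF cont]) auto
    have "integral {0..L} (\<lambda>t. b (q + t\<^sup>2) * (K q t - K q 0))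
        = integral {0..L} (\<lambda>t. b (q + t\<^sup>2) * K q t) - integral {0..L} (\<lambda>t. b (q + t\<^sup>2) * K q 0)"
      using integral_diff[OF int1 int2] by (simp add: right_diff_distrib)
    also have "\<dots> = - (abel L b q * K q 0)"
      using eq[OF q] by (simp add: abel_def)
    finally have "\<bar>K q 0\<bar> * \<bar>abel L b q\<bar> = \<bar>integral {0..L} (\<lambda>t. b (q + t\<^sup>2) * (K q t - K q 0))\<bar>"
      by (simp add: abs_mult mult.commute)
    also have "\<dots> \<le> C * integral {0..L} (\<lambda>t. \<bar>G (q + t\<^sup>2)\<bar>)"
    proof (rule integration_by_parts_flat_kernel[OF cont derG])
      show "G (q + L\<^sup>2) = 0"
        using q \<open>0 \<le> p1\<close> \<open>B \<le> L\<^sup>2\<close> by (intro G0) simp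
    qed (use derK[OF q] K'[OF q] \<open>0 < L\<close> in auto)
    also have "integral {0..L} (\<lambda>t. \<bar>G (q + t\<^sup>2)\<bar>) \<le> integral {0..L} (\<lambda>t. M * (B - q) * ?H (q + t\<^sup>2))"
    proof (rule integral_le)
      show "(\<lambda>t. \<bar>G (q + t\<^sup>2)\<bar>) integrable_on {0..L}"
        by (intro integrable_continuous_interval continuous_intros continuous_on_compose2[OF contG]) auto
      show "(\<lambda>t. M * (B - q) * ?H (q + t\<^sup>2)) integrable_on {0..L}"
        by (intro integrable_continuous_interval continuous_intros)
      show "\<bar>G (q + t\<^sup>2)\<bar> \<le> M * (B - q) * ?H (q + t\<^sup>2)" for t
      proof (cases "q + t\<^sup>2 \<le> B")
        case True
        have "\<bar>G (q + t\<^sup>2)\<bar> \<le> M * (B - (q + t\<^sup>2)) ^ Suc n"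
          using True q by (intro flat) (auto intro: add_increasing2)
        also have "\<dots> = M * ((B - (q + t\<^sup>2)) * (B - (q + t\<^sup>2)) ^ n)" by simp
        also have "\<dots> \<le> M * ((B - q) * (B - (q + t\<^sup>2)) ^ n)"
          using True \<open>0 \<le> M\<close> by (intro mult_left_mono mult_right_mono) auto
        finally show ?thesis using True by (simp add: max_def mult.assoc)
      next
        case False
        then show ?thesis using G0[of "q + t\<^sup>2"] q \<open>0 \<le> M\<close> by simp
      qed
    qed
    also have "\<dots> = M * (B - q) * abel L ?H q" by (simp add: abel_def)
    finally have "\<bar>K q 0\<bar> * \<bar>abel L b q\<bar> \<le> C * (M * (B - q) * abel L ?H q)"
      using \<open>0 \<le> C\<close> by (simp add: mult_left_mono)
    then have "c * (B - q) * \<bar>abel L b q\<bar> \<le> C * (M * (B - q) * abel L ?H q)"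
      using mult_right_mono[OF diag[OF q], of "\<bar>abel L b q\<bar>"] by simp
    then have "(B - q) * (c * \<bar>abel L b q\<bar>) \<le> (B - q) * (C * M * abel L ?H q)"
      by (simp add: mult_ac)
    then have "c * \<bar>abel L b q\<bar> \<le> C * M * abel L ?H q"
      using q by simp
    then show ?thesis using \<open>0 < c\<close> by (simp add: field_simps)
  qed
  have GL: "G (L\<^sup>2) = 0" using G0 \<open>B \<le> L\<^sup>2\<close> by simp
  have "pi / 4 * \<bar>G p\<bar> = \<bar>abel L (abel L b) p\<bar>"
    using p \<open>0 \<le> p1\<close> \<open>0 < L\<close> \<open>B \<le> L\<^sup>2\<close> vanish
    by (subst abel_abel[OF cont _ _ _ derG GL]) (auto simp: abs_mult)
  also have "\<dots> = norm (integral {0..L} (\<lambda>u. abel L b (p + u\<^sup>2)))"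
    by (simp add: abel_def[of L "abel L b"])
  also have "\<dots> \<le> integral {0..L} (\<lambda>u. C / c * M * abel L ?H (p + u\<^sup>2))"
  proof (rule integral_norm_bound_integral)
    show "(\<lambda>u. abel L b (p + u\<^sup>2)) integrable_on {0..L}"
      by (rule integrable_abel[OF continuous_on_abel[OF cont]])
    show "(\<lambda>u. C / c * M * abel L ?H (p + u\<^sup>2)) integrable_on {0..L}"
      by (rule integrable_on_mult_right[OF integrable_abel[OF continuous_on_abel[OF contH]]])
    show "norm (abel L b (p + u\<^sup>2)) \<le> C / c * M * abel L ?H (p + u\<^sup>2)" for u
      using abel_bound[of "p + u\<^sup>2"] p by (simp add: add_increasing2)
  qed
  also have "\<dots> = C / c * M * abel L (abel L ?H) p"
    by (simp add: abel_def[of L "abel L ?H"])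
  also have "\<dots> = C / c * M * (pi / 4 * ((B - p) ^ Suc n / Suc n))"
    using assms by (subst abel_power) auto
  also have "\<dots> = pi / 4 * (C / c * M / Suc n * (B - p) ^ Suc n)"
    using \<open>0 < c\<close> by (simp add: field_simps)
  finally have "pi / 4 * \<bar>G p\<bar> \<le> pi / 4 * (C / c * M / Suc n * (B - p) ^ Suc n)" .
  then show ?thesis
    by (rule mult_left_le_imp_le) simp
qed

text \<open>
  Flatness of \<open>b\<close> at \<open>B\<close> supplies a power bound of an order \<open>n\<close> so high that each application of
  the contraction at least halves the constant.
\<close>

lemma generalized_abel_local_uniqueness:
  fixes b :: "real \<Rightarrow> real" and K K' :: "real \<Rightarrow> real \<Rightarrow> real"
  assumes "0 < L" "B \<le> L\<^sup>2" "0 \<le> p1" and cont: "continuous_on UNIV b"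
    and vanish: "\<And>q. B \<le> q \<Longrightarrow> b q = 0"
    and derK: "\<And>p t. p1 \<le> p \<Longrightarrow> p < B \<Longrightarrow> (K p has_real_derivative K' p t) (at t)"
    and K': "\<And>p t. p1 \<le> p \<Longrightarrow> p < B \<Longrightarrow> 0 \<le> t \<Longrightarrow> t \<le> L \<Longrightarrow> \<bar>K' p t\<bar> \<le> C * t"
    and eq: "\<And>p. p1 \<le> p \<Longrightarrow> p < B \<Longrightarrow> integral {0..L} (\<lambda>t. b (p + t\<^sup>2) * K p t) = 0"
    and "0 < c" and diag: "\<And>p. p1 \<le> p \<Longrightarrow> p < B \<Longrightarrow> c * (B - p) \<le> \<bar>K p 0\<bar>"
    and "0 \<le> C"
    and flat: "\<And>n. \<exists>M. \<forall>q\<in>{p1..B}. \<bar>b q\<bar> \<le> M * (B - q) ^ n"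
    and q: "p1 < q"
  shows "b q = 0"
proof (cases "q < B")
  case False
  then show ?thesis using vanish by simp
next
  case True
  obtain G where derG: "\<And>q. (G has_real_derivative - b q) (at q)" and GB: "G B = 0"
    using antiderivative_UNIV[OF cont, of B] by blast
  \<comment> \<open>With this order the contraction factor \<open>C / c / Suc n\<close> is at most one half.\<close>
  obtain n0 :: nat where n0: "2 * (C / c) \<le> n0"
    using real_arch_simple by blast
  define n where "n = Suc n0"
  obtain M0 where M0: "\<And>q. q \<in> {p1..B} \<Longrightarrow> \<bar>b q\<bar> \<le> M0 * (B - q) ^ n"
    using flat by blast
  define M where "M = max 0 M0"
  have flatG: "\<bar>G p\<bar> \<le> M * (B - p) ^ Suc n" if p: "p1 \<le> p" "p \<le> B" for p
  proof (cases "p = B")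
    case False
    with p have "p < B" by simp
    obtain z where z: "p < z" "z < B" "G B - G p = (B - p) * - b z"
      using MVT2[OF \<open>p < B\<close>, of G "\<lambda>q. - b q"] derG by blast
    have "\<bar>b z\<bar> \<le> M0 * (B - z) ^ n" using z p by (intro M0) auto
    also have "\<dots> \<le> M * (B - p) ^ n"
      using z p by (intro mult_mono power_mono) (auto simp: M_def)
    finally have "(B - p) * \<bar>b z\<bar> \<le> (B - p) * (M * (B - p) ^ n)"
      using p by (intro mult_left_mono) auto
    moreover have "\<bar>G p\<bar> = (B - p) * \<bar>b z\<bar>"
      using z(3) GB p by (simp add: abs_mult)
    ultimately show ?thesis by (simp add: mult_ac)
  qed (simp add: GB)
  have half: "x / Suc n \<le> 1 / 2" if "2 * x \<le> n0" for x :: real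
    using that by (simp add: n_def pos_divide_le_eq)
  have halving: "\<bar>G p\<bar> \<le> M / 2 ^ j * (B - p) ^ Suc n" if "p1 \<le> p" "p \<le> B" for j p
    using that
  proof (induction j arbitrary: p)
    case (Suc j)
    have "\<bar>G p\<bar> \<le> C / c * (M / 2 ^ j) / Suc n * (B - p) ^ Suc n"
      by (rule generalized_abel_contraction[where b = b and L = L and ?p1.0 = p1 and K = K and K' = K'])
         (use assms derG GB Suc in \<open>auto simp: n_def M_def\<close>)
    also have "\<dots> = (C / c / Suc n) * (M / 2 ^ j * (B - p) ^ Suc n)"
      by (simp add: mult_ac)
    also have "\<dots> \<le> (1 / 2) * (M / 2 ^ j * (B - p) ^ Suc n)"
      using Suc.prems by (intro mult_right_mono[OF half[OF n0]] mult_nonneg_nonneg zero_le_power)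
        (auto simp: M_def)
    finally show ?case by simp
  qed (use flatG in simp)
  have Gzero: "G p = 0" if p: "p1 \<le> p" "p \<le> B" for p
  proof -
    have "(\<lambda>j. M * (B - p) ^ Suc n * (1 / 2) ^ j) \<longlonglongrightarrow> M * (B - p) ^ Suc n * 0"
      by (intro tendsto_mult tendsto_const LIMSEQ_power_zero) simp
    moreover have "\<bar>G p\<bar> \<le> M * (B - p) ^ Suc n * (1 / 2) ^ j" for j
      using halving[OF p, of j] by (simp add: power_divide mult_ac)
    ultimately have "\<bar>G p\<bar> \<le> 0"
      using LIMSEQ_le_const[of _ "0::real" "\<bar>G p\<bar>"] by auto
    then show ?thesis by simp
  qed
  have "(G has_real_derivative 0) (at q)"
  proof (rule has_field_derivative_transform_within_open[where f = "\<lambda>_. 0" and S = "{p1<..<B}"])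
    show "((\<lambda>_. 0) has_real_derivative 0) (at q)" by simp
  qed (use q True Gzero in auto)
  with derG[of q] show ?thesis using DERIV_unique by fastforce
qed

section \<open>Moments of a smooth function over circles\<close>

lemma smooth_imp_differentiable: "smooth f \<Longrightarrow> f differentiable (at x)"
  unfolding smooth_def by (metis C_diff.simps(2))

lemma smooth_imp_continuous_on: "smooth f \<Longrightarrow> continuous_on S f"
  unfolding smooth_def by (metis C_diff.simps(1) continuous_on_subset subset_UNIV)

lemma smooth_frechet_derivative: "smooth f \<Longrightarrow> smooth (\<lambda>x. frechet_derivative f (at x) v)"
  unfolding smooth_def by (metis C_diff.simps(2))

lemma unit_dir_eq_axis: "unit_dir \<theta> = cos \<theta> *\<^sub>R axis 1 1 + sin \<theta> *\<^sub>R axis 2 1"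
  by (simp add: unit_dir_def vec_eq_iff forall_2 axis_def)

lemma continuous_on_unit_dir [continuous_intros]:
  fixes f :: "'a::t2_space \<Rightarrow> real"
  assumes "continuous_on S f"
  shows "continuous_on S (\<lambda>x. unit_dir (f x))"
  unfolding unit_dir_eq_axis by (intro continuous_intros assms)

lemma norm_unit_dir [simp]: "norm (unit_dir \<theta>) = 1"
  by (simp add: unit_dir_def norm_vec_def L2_set_def sum_2)

definition circle_moment :: "(real^2 \<Rightarrow> real) \<Rightarrow> (real \<Rightarrow> real) \<Rightarrow> real \<Rightarrow> real" where
  "circle_moment f w \<rho> = integral {0..2 * pi} (\<lambda>\<theta>. f (\<rho> *\<^sub>R unit_dir \<theta>) * w \<theta>)"

lemma circle_moment_has_derivative:
  fixes f :: "real^2 \<Rightarrow> real"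
  assumes f: "smooth f" and w: "continuous_on UNIV w"
  shows "(circle_moment f w has_real_derivative
     circle_moment (\<lambda>x. frechet_derivative f (at x) (axis 1 1)) (\<lambda>\<theta>. w \<theta> * cos \<theta>) \<rho> +
     circle_moment (\<lambda>x. frechet_derivative f (at x) (axis 2 1)) (\<lambda>\<theta>. w \<theta> * sin \<theta>) \<rho>) (at \<rho>)"
proof -
  define f1 where "f1 x = frechet_derivative f (at x) (axis 1 1)" for x
  define f2 where "f2 x = frechet_derivative f (at x) (axis 2 1)" for x
  define D where "D \<rho> \<theta> = f1 (\<rho> *\<^sub>R unit_dir \<theta>) * (w \<theta> * cos \<theta>) + f2 (\<rho> *\<^sub>R unit_dir \<theta>) * (w \<theta> * sin \<theta>)"
    for \<rho> \<theta>
  have cf: "continuous_on UNIV f" "continuous_on UNIV f1" "continuous_on UNIV f2"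
    unfolding f1_def f2_def using f by (auto intro: smooth_imp_continuous_on smooth_frechet_derivative)
  have "((\<lambda>\<rho>. integral (cbox 0 (2 * pi)) (\<lambda>\<theta>. f (\<rho> *\<^sub>R unit_dir \<theta>) * w \<theta>)) has_real_derivative
      integral (cbox 0 (2 * pi)) (D \<rho>)) (at \<rho> within UNIV)"
  proof (rule leibniz_rule_field_derivative)
    fix r \<theta> :: real
    have "(f has_derivative frechet_derivative f (at (r *\<^sub>R unit_dir \<theta>))) (at (r *\<^sub>R unit_dir \<theta>))"
      using smooth_imp_differentiable[OF f] frechet_derivative_works by blast
    moreover have "((\<lambda>r. r *\<^sub>R unit_dir \<theta>) has_derivative (\<lambda>h. h *\<^sub>R unit_dir \<theta>)) (at r)"
      by (auto intro!: derivative_eq_intros)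
    ultimately have "((\<lambda>r. f (r *\<^sub>R unit_dir \<theta>)) has_derivative
        (\<lambda>h. frechet_derivative f (at (r *\<^sub>R unit_dir \<theta>)) (h *\<^sub>R unit_dir \<theta>))) (at r)"
      using diff_chain_at[of "\<lambda>r. r *\<^sub>R unit_dir \<theta>"] by (simp add: o_def)
    moreover have "frechet_derivative f (at (r *\<^sub>R unit_dir \<theta>)) (h *\<^sub>R unit_dir \<theta>)
        = (cos \<theta> * f1 (r *\<^sub>R unit_dir \<theta>) + sin \<theta> * f2 (r *\<^sub>R unit_dir \<theta>)) * h" for h
    proof -
      have "linear (frechet_derivative f (at (r *\<^sub>R unit_dir \<theta>)))"
        using smooth_imp_differentiable[OF f] linear_frechet_derivative by blast
      then show ?thesis
        unfolding unit_dir_eq_axis[of \<theta>] f1_def f2_def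
        by (simp add: linear_add linear_cmul algebra_simps)
    qed
    ultimately have "((\<lambda>r. f (r *\<^sub>R unit_dir \<theta>)) has_real_derivative
        cos \<theta> * f1 (r *\<^sub>R unit_dir \<theta>) + sin \<theta> * f2 (r *\<^sub>R unit_dir \<theta>)) (at r)"
      by (simp add: has_field_derivative_def)
    from DERIV_cmult_right[OF this, of "w \<theta>"]
    show "((\<lambda>r. f (r *\<^sub>R unit_dir \<theta>) * w \<theta>) has_real_derivative D r \<theta>) (at r within UNIV)"
      by (rule DERIV_cong) (simp add: D_def algebra_simps)
  next
    show "(\<lambda>\<theta>. f (r *\<^sub>R unit_dir \<theta>) * w \<theta>) integrable_on cbox 0 (2 * pi)" for r
      by (intro integrable_continuous continuous_intros continuous_on_compose2[OF cf(1)]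
            continuous_on_subset[OF w]) auto
    show "continuous_on (UNIV \<times> cbox 0 (2 * pi)) (\<lambda>(r, \<theta>). D r \<theta>)"
      unfolding D_def case_prod_beta
      by (intro continuous_intros continuous_on_compose2[OF cf(2)] continuous_on_compose2[OF cf(3)]
            continuous_on_compose2[OF w]) auto
  qed auto
  moreover have "integral (cbox 0 (2 * pi)) (D \<rho>) =
      circle_moment f1 (\<lambda>\<theta>. w \<theta> * cos \<theta>) \<rho> + circle_moment f2 (\<lambda>\<theta>. w \<theta> * sin \<theta>) \<rho>"
    unfolding circle_moment_def D_def cbox_interval
    by (intro integral_add integrable_continuous_interval continuous_intros
          continuous_on_compose2[OF cf(2)] continuous_on_compose2[OF cf(3)] continuous_on_subset[OF w]) auto
  ultimately show ?thesis
    by (simp add: circle_moment_def[abs_def] f1_def[abs_def] f2_def[abs_def])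
qed

text \<open>
  The radial derivative of a moment is a sum of two moments of partial derivatives. Closing
  the moments under addition gives a class of functions that is stable under differentiation, which
  is all that is needed to differentiate a moment arbitrarily often.
\<close>

inductive moment_sum :: "(real \<Rightarrow> real) \<Rightarrow> bool" where
  moment: "smooth f \<Longrightarrow> continuous_on UNIV w \<Longrightarrow> moment_sum (circle_moment f w)"
| add: "moment_sum g \<Longrightarrow> moment_sum h \<Longrightarrow> moment_sum (\<lambda>\<rho>. g \<rho> + h \<rho>)"

lemma moment_sum_derivative:
  assumes "moment_sum g"
  shows "\<exists>g'. moment_sum g' \<and> (\<forall>\<rho>. (g has_real_derivative g' \<rho>) (at \<rho>))"
  using assms
proof induction
  case (moment f w)
  have "continuous_on UNIV (\<lambda>\<theta>. w \<theta> * cos \<theta>)" "continuous_on UNIV (\<lambda>\<theta>. w \<theta> * sin \<theta>)"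
    by (intro continuous_intros moment)+
  then show ?case
    using circle_moment_has_derivative[OF moment] smooth_frechet_derivative[OF moment(1)]
    by (blast intro: moment_sum.intros)
next
  case (add g h)
  then obtain g' h' where
    "moment_sum g'" "\<And>\<rho>. (g has_real_derivative g' \<rho>) (at \<rho>)"
    "moment_sum h'" "\<And>\<rho>. (h has_real_derivative h' \<rho>) (at \<rho>)" by blast
  then show ?case by (blast intro: moment_sum.add DERIV_add)
qed

lemma continuous_on_moment_sum: "moment_sum g \<Longrightarrow> continuous_on S g"
  using moment_sum_derivative
  by (metis DERIV_isCont continuous_at_imp_continuous_on)

text \<open>
  All derivatives vanish at \<open>B\<close>, and by induction on \<open>n\<close> the mean value theorem turns an estimate of
  order \<open>n\<close> for the derivative into one of order \<open>Suc n\<close> for the function.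
\<close>

lemma moment_sum_flat:
  assumes "moment_sum g" "\<And>\<rho>. B \<le> \<rho> \<Longrightarrow> g \<rho> = 0"
  shows "\<exists>M\<ge>0. \<forall>\<rho>\<in>{A..B}. \<bar>g \<rho>\<bar> \<le> M * (B - \<rho>) ^ n"
  using assms
proof (induction n arbitrary: g)
  case 0
  have "compact (g ` {A..B})"
    by (intro compact_continuous_image continuous_on_moment_sum 0) auto
  then obtain M where "\<forall>y\<in>g ` {A..B}. \<bar>y\<bar> \<le> M"
    using compact_imp_bounded bounded_real by metis
  then show ?case by (intro exI[of _ "max 0 M"]) (auto simp: le_max_iff_disj)
next
  case (Suc n)
  obtain g' where g': "moment_sum g'" "\<And>\<rho>. (g has_real_derivative g' \<rho>) (at \<rho>)"
    using moment_sum_derivative[OF Suc.prems(1)] by blast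
  have vanish': "g' \<rho> = 0" if "B \<le> \<rho>" for \<rho>
  proof (rule continuous_constant_on_closure[where f = g' and S = "{B<..}"])
    show "continuous_on (closure {B<..}) g'" by (rule continuous_on_moment_sum[OF g'(1)])
    show "g' x = 0" if "x \<in> {B<..}" for x
    proof -
      have "(g has_real_derivative 0) (at x)"
        by (rule has_field_derivative_transform_within_open[where f = "\<lambda>_. 0" and S = "{B<..}"])
           (use that Suc.prems(2) in auto)
      then show ?thesis using g'(2) DERIV_unique by blast
    qed
    show "\<rho> \<in> closure {B<..}" using that by (simp add: closure_greaterThan)
  qed
  obtain M where M: "M \<ge> 0" "\<And>\<rho>. \<rho> \<in> {A..B} \<Longrightarrow> \<bar>g' \<rho>\<bar> \<le> M * (B - \<rho>) ^ n"
    using Suc.IH[OF g'(1) vanish'] by blast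
  show ?case
  proof (intro exI[of _ M] conjI ballI M(1))
    fix \<rho> assume \<rho>: "\<rho> \<in> {A..B}"
    show "\<bar>g \<rho>\<bar> \<le> M * (B - \<rho>) ^ Suc n"
    proof (cases "\<rho> = B")
      case False
      with \<rho> have "\<rho> < B" by simp
      obtain z where z: "\<rho> < z" "z < B" "g B - g \<rho> = (B - \<rho>) * g' z"
        using MVT2[OF \<open>\<rho> < B\<close>, of g g'] g'(2) by blast
      have "\<bar>g' z\<bar> \<le> M * (B - z) ^ n" using z \<rho> by (intro M) auto
      also have "\<dots> \<le> M * (B - \<rho>) ^ n"
        using z M(1) by (intro mult_left_mono power_mono) auto
      finally have "(B - \<rho>) * \<bar>g' z\<bar> \<le> (B - \<rho>) * (M * (B - \<rho>) ^ n)"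
        using \<rho> by (intro mult_left_mono) auto
      moreover have "g \<rho> = - ((B - \<rho>) * g' z)"
        using z(3) Suc.prems(2)[of B] by simp
      then have "\<bar>g \<rho>\<bar> = (B - \<rho>) * \<bar>g' z\<bar>"
        using \<rho> by (simp add: abs_mult)
      ultimately show ?thesis by (simp add: mult_ac)
    qed (use Suc.prems(2) in simp)
  qed
qed

section \<open>The kernel of the attenuated transform\<close>

text \<open>
  Folding the line at the foot of the perpendicular makes the kernel even, so that its
  derivative is \<open>O(t)\<close> as soon as its second derivative is bounded.
\<close>

lemma even_part_second_order:
  fixes g g' g'' :: "real \<Rightarrow> real"
  assumes g: "\<And>t. (g has_real_derivative g' t) (at t)"
    and g': "\<And>t. (g' has_real_derivative g'' t) (at t)"
    and bound: "\<And>t. \<bar>t\<bar> \<le> L \<Longrightarrow> \<bar>g'' t\<bar> \<le> C"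
  shows "((\<lambda>t. g t + g (- t)) has_real_derivative g' t - g' (- t)) (at t)"
    and "0 \<le> t \<Longrightarrow> t \<le> L \<Longrightarrow> \<bar>g' t - g' (- t)\<bar> \<le> 2 * C * t"
proof -
  have "((\<lambda>t. g (- t)) has_real_derivative g' (- t) * - 1) (at t)"
    by (rule DERIV_chain2[OF g]) (auto intro!: derivative_eq_intros)
  from DERIV_add[OF g this] show "((\<lambda>t. g t + g (- t)) has_real_derivative g' t - g' (- t)) (at t)"
    by simp
  show "\<bar>g' t - g' (- t)\<bar> \<le> 2 * C * t" if t: "0 \<le> t" "t \<le> L"
  proof (cases "t = 0")
    case False
    with t have "- t < t" by simp
    obtain z where z: "- t < z" "z < t" "g' t - g' (- t) = (t - - t) * g'' z"
      using MVT2[OF \<open>- t < t\<close>, of g' g''] g' by blast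
    have "2 * t * \<bar>g'' z\<bar> \<le> 2 * t * C"
      using z t by (intro mult_left_mono bound) auto
    then show ?thesis using z(3) t by (simp add: abs_mult mult_ac)
  qed simp
qed

text \<open>
  The weight that the \<open>n\<close>-th angular mode picks up along one line at distance \<open>s\<close> from the origin,
  up to a factor that does not depend on \<open>t\<close>.
  Here \<open>t\<close> is the coordinate on the line, measured from the foot of the perpendicular towards the
  vertex; \<open>\<alpha>\<close> is the angle between the foot and the vertex, and \<open>arctan (t / s)\<close> the angle between
  the foot and the point at \<open>t\<close>.
\<close>

definition branch_kernel :: "real \<Rightarrow> int \<Rightarrow> real \<Rightarrow> real \<Rightarrow> real \<Rightarrow> real" where
  "branch_kernel \<mu> n \<alpha> s t = exp (\<mu> * t) * cos (n * (\<alpha> - arctan (t / s)))"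

text \<open>
  For bounded \<open>t\<close> the bound is uniform in \<open>\<alpha>\<close> and in \<open>s \<ge> s0\<close>; it degenerates only as the line approaches the origin,
  where the angle turns infinitely fast.
\<close>

lemma branch_kernel_derivatives:
  assumes "0 < s0"
  shows "\<exists>C\<ge>0. \<forall>\<alpha>. \<forall>s\<ge>s0. \<exists>g' g''.
       (\<forall>t. (branch_kernel \<mu> n \<alpha> s has_real_derivative g' t) (at t)) \<and>
       (\<forall>t. (g' has_real_derivative g'' t) (at t)) \<and> (\<forall>t. \<bar>t\<bar> \<le> L \<longrightarrow> \<bar>g'' t\<bar> \<le> C)"
proof -
  define E where "E = exp (\<bar>\<mu>\<bar> * L)"
  define C where "C = E * (\<mu>\<^sup>2 + 2 * (\<bar>\<mu>\<bar> * \<bar>real_of_int n\<bar> * (1 / s0)) + \<bar>real_of_int n\<bar> * (2 / s0\<^sup>2) + (real_of_int n)\<^sup>2 * (1 / s0\<^sup>2))"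
  show ?thesis
  proof (intro exI[of _ C] conjI allI impI)
    show "0 \<le> C" unfolding C_def E_def using \<open>0 < s0\<close>
      by (intro mult_nonneg_nonneg add_nonneg_nonneg) auto
    fix \<alpha> s :: real assume s: "s0 \<le> s"
    with \<open>0 < s0\<close> have "0 < s" by simp
    define A where "A t = n * (\<alpha> - arctan (t / s))" for t
    define w where "w t = s / (s\<^sup>2 + t\<^sup>2)" for t
    define w' where "w' t = - (2 * s * t) / (s\<^sup>2 + t\<^sup>2)\<^sup>2" for t
    define g' where "g' t = exp (\<mu> * t) * (\<mu> * cos (A t) + n * w t * sin (A t))" for t
    define g'' where "g'' t = exp (\<mu> * t) * (\<mu>\<^sup>2 * cos (A t) + 2 * (\<mu> * n * w t * sin (A t))
        + n * w' t * sin (A t) - (n * w t)\<^sup>2 * cos (A t))" for t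
    have pos: "0 < s\<^sup>2 + t\<^sup>2" for t using \<open>0 < s\<close> by (simp add: add_pos_nonneg)
    have derA: "(A has_real_derivative - (n * w t)) (at t)" for t
    proof -
      have "((\<lambda>t. arctan (t / s)) has_real_derivative inverse (1 + (t / s)\<^sup>2) * (1 / s)) (at t)"
        by (rule DERIV_chain2[OF DERIV_arctan]) (use \<open>0 < s\<close> in \<open>auto intro!: derivative_eq_intros\<close>)
      moreover have "inverse (1 + (t / s)\<^sup>2) * (1 / s) = w t"
      proof -
        have "(1 + (t / s)\<^sup>2) * s\<^sup>2 = s\<^sup>2 + t\<^sup>2"
          using \<open>0 < s\<close> by (simp add: power_divide distrib_right)
        then have "1 + (t / s)\<^sup>2 = (s\<^sup>2 + t\<^sup>2) / s\<^sup>2"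
          using \<open>0 < s\<close> by (simp add: eq_divide_eq)
        then show ?thesis using \<open>0 < s\<close> by (simp add: w_def power2_eq_square)
      qed
      ultimately have "((\<lambda>t. arctan (t / s)) has_real_derivative w t) (at t)" by simp
      from DERIV_cmult[OF DERIV_diff[OF DERIV_const this], of "real_of_int n" \<alpha>]
      show ?thesis by (simp add: A_def[abs_def])
    qed
    have derw: "(w has_real_derivative w' t) (at t)" for t
      unfolding w_def[abs_def] w'_def using pos[of t]
      by (auto intro!: derivative_eq_intros simp: power2_eq_square)
    have derexp: "((\<lambda>t. exp (\<mu> * t)) has_real_derivative exp (\<mu> * t) * \<mu>) (at t)" for t
      by (auto intro!: derivative_eq_intros)
    have dercos: "((\<lambda>t. cos (A t)) has_real_derivative n * w t * sin (A t)) (at t)" for t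
      using DERIV_chain2[OF DERIV_cos derA, of t] by (simp add: mult_ac)
    have dersin: "((\<lambda>t. sin (A t)) has_real_derivative - (n * w t * cos (A t))) (at t)" for t
      using DERIV_chain2[OF DERIV_sin derA, of t] by (simp add: mult_ac)
    have "(branch_kernel \<mu> n \<alpha> s has_real_derivative g' t) (at t)" for t
    proof -
      have "branch_kernel \<mu> n \<alpha> s = (\<lambda>t. exp (\<mu> * t) * cos (A t))"
        by (simp add: branch_kernel_def A_def fun_eq_iff)
      with DERIV_mult[OF derexp dercos, of t] show ?thesis
        by (simp add: g'_def algebra_simps)
    qed
    moreover have "(g' has_real_derivative g'' t) (at t)" for t
    proof -
      have "((\<lambda>t. \<mu> * cos (A t) + n * w t * sin (A t)) has_real_derivative
          \<mu> * (n * w t * sin (A t)) + (n * w' t * sin (A t) + - (n * w t * cos (A t)) * (n * w t))) (at t)"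
        by (intro DERIV_add DERIV_cmult DERIV_mult dercos dersin derw)
      from DERIV_mult[OF derexp this] show ?thesis
        unfolding g'_def[abs_def]
        by (rule DERIV_cong) (simp add: g''_def power2_eq_square algebra_simps)
    qed
    moreover have "\<bar>g'' t\<bar> \<le> C" if "\<bar>t\<bar> \<le> L" for t
    proof -
      have sc: "\<bar>sin (A t)\<bar> \<le> 1" "\<bar>cos (A t)\<bar> \<le> 1" by auto
      have w: "\<bar>w t\<bar> \<le> 1 / s0"
      proof -
        have "s * s0 \<le> s\<^sup>2 + t\<^sup>2"
          using s \<open>0 < s\<close> mult_left_mono[of s0 s s] by (simp add: power2_eq_square add_increasing2)
        then show ?thesis using \<open>0 < s\<close> \<open>0 < s0\<close> pos[of t] by (simp add: w_def frac_le_eq divide_le_eq field_simps)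
      qed
      have w2: "(w t)\<^sup>2 \<le> 1 / s0\<^sup>2"
        using power_mono[OF w, of 2] by (simp add: power_divide)
      have w': "\<bar>w' t\<bar> \<le> 2 / s0\<^sup>2"
      proof -
        have 1: "2 * s * \<bar>t\<bar> \<le> s\<^sup>2 + t\<^sup>2"
          using sum_squares_bound[of s "\<bar>t\<bar>"] by simp
        have 2: "s0\<^sup>2 \<le> s\<^sup>2 + t\<^sup>2"
          using power_mono[OF s, of 2] \<open>0 < s0\<close> by (simp add: add_increasing2)
        have "\<bar>w' t\<bar> = (2 * s * \<bar>t\<bar>) / ((s\<^sup>2 + t\<^sup>2) * (s\<^sup>2 + t\<^sup>2))"
          using \<open>0 < s\<close> by (simp add: w'_def abs_mult power2_eq_square)
        also have "\<dots> \<le> (s\<^sup>2 + t\<^sup>2) / ((s\<^sup>2 + t\<^sup>2) * (s\<^sup>2 + t\<^sup>2))"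
          using 1 by (intro divide_right_mono) auto
        also have "\<dots> = 1 / (s\<^sup>2 + t\<^sup>2)" using pos[of t] by simp
        also have "\<dots> \<le> 1 / s0\<^sup>2" using 2 \<open>0 < s0\<close> by (intro divide_left_mono mult_pos_pos pos) auto
        also have "\<dots> \<le> 2 / s0\<^sup>2" by (intro divide_right_mono) auto
        finally show ?thesis .
      qed
      have "exp (\<mu> * t) \<le> E"
      proof -
        have "\<mu> * t \<le> \<bar>\<mu>\<bar> * \<bar>t\<bar>" by (metis abs_ge_self abs_mult)
        also have "\<dots> \<le> \<bar>\<mu>\<bar> * L" using that by (intro mult_left_mono) auto
        finally show ?thesis by (simp add: E_def)
      qed
      have one: "\<bar>a * b\<bar> \<le> c" if "\<bar>a\<bar> \<le> c" "\<bar>b\<bar> \<le> 1" for a b c :: real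
        using mult_mono[OF that] that by (simp add: abs_mult)
      have "\<bar>\<mu>\<^sup>2 * cos (A t)\<bar> \<le> \<mu>\<^sup>2" by (rule one) (use sc in auto)
      moreover have "\<bar>\<mu> * n * w t * sin (A t)\<bar> \<le> \<bar>\<mu>\<bar> * \<bar>real_of_int n\<bar> * (1 / s0)"
        by (rule one) (use sc mult_left_mono[OF w, of "\<bar>\<mu>\<bar> * \<bar>real_of_int n\<bar>"] in \<open>auto simp: abs_mult\<close>)
      moreover have "\<bar>n * w' t * sin (A t)\<bar> \<le> \<bar>real_of_int n\<bar> * (2 / s0\<^sup>2)"
        by (rule one) (use sc mult_left_mono[OF w', of "\<bar>real_of_int n\<bar>"] in \<open>auto simp: abs_mult\<close>)
      moreover have "\<bar>(n * w t)\<^sup>2 * cos (A t)\<bar> \<le> (real_of_int n)\<^sup>2 * (1 / s0\<^sup>2)"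
        by (rule one) (use sc mult_left_mono[OF w2, of "(real_of_int n)\<^sup>2"] in \<open>auto simp: power_mult_distrib\<close>)
      ultimately have "\<bar>\<mu>\<^sup>2 * cos (A t) + 2 * (\<mu> * n * w t * sin (A t))
          + n * w' t * sin (A t) - (n * w t)\<^sup>2 * cos (A t)\<bar>
        \<le> \<mu>\<^sup>2 + 2 * (\<bar>\<mu>\<bar> * \<bar>real_of_int n\<bar> * (1 / s0)) + \<bar>real_of_int n\<bar> * (2 / s0\<^sup>2) + (real_of_int n)\<^sup>2 * (1 / s0\<^sup>2)"
        by linarith
      then show ?thesis
        unfolding g''_def C_def abs_mult using \<open>exp (\<mu> * t) \<le> E\<close>
        by (intro mult_mono) (auto simp: E_def)
    qed
    ultimately show "\<exists>g' g''. (\<forall>t. (branch_kernel \<mu> n \<alpha> s has_real_derivative g' t) (at t)) \<and>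
       (\<forall>t. (g' has_real_derivative g'' t) (at t)) \<and> (\<forall>t. \<bar>t\<bar> \<le> L \<longrightarrow> \<bar>g'' t\<bar> \<le> C)"
      by blast
  qed
qed

text \<open>
  The diagonal of the kernel is the Chebyshev function of order \<open>n\<close> in \<open>sqrt p / L\<close>. Its zeros in the
  interior are simple because sine and cosine have no common zero.
\<close>

lemma cos_multiple_arccos_simple_zero:
  assumes "0 < L" "0 < B" "B < L\<^sup>2"
  obtains D where "((\<lambda>p. cos (real_of_int n * arccos (sqrt p / L))) has_real_derivative D) (at B)"
    "cos (real_of_int n * arccos (sqrt B / L)) \<noteq> 0 \<or> D \<noteq> 0"
proof -
  let ?x = "sqrt B / L"
  have x: "-1 < ?x" "?x < 1"
    using assms real_sqrt_less_mono[OF \<open>B < L\<^sup>2\<close>] by (auto intro: less_trans[of _ 0])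
  define d where "d = inverse (- sqrt (1 - ?x\<^sup>2)) * (inverse (sqrt B) / 2 / L)"
  have der: "((\<lambda>p. arccos (sqrt p / L)) has_real_derivative d) (at B)"
    unfolding d_def
    by (rule DERIV_chain2[where f = arccos and g = "\<lambda>p. sqrt p / L", OF DERIV_arccos[OF x]]) (use assms in \<open>auto intro!: derivative_eq_intros DERIV_real_sqrt simp: field_simps\<close>)
  have "d \<noteq> 0"
    using x assms abs_square_eq_1[of ?x] by (auto simp: d_def)
  show ?thesis
  proof (rule that[of "- sin (n * arccos ?x) * (n * d)"])
    show "((\<lambda>p. cos (real_of_int n * arccos (sqrt p / L))) has_real_derivative
        - sin (n * arccos ?x) * (n * d)) (at B)"
      by (rule DERIV_chain2[OF DERIV_cos DERIV_cmult[OF der]])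
    show "cos (real_of_int n * arccos ?x) \<noteq> 0 \<or> - sin (n * arccos ?x) * (n * d) \<noteq> 0"
      using \<open>d \<noteq> 0\<close> sin_zero_norm_cos_one[of "n * arccos ?x"] by (cases "n = 0") auto
  qed
qed

section \<open>From the transform to generalized Abel equations\<close>

lemma integral_periodic_shift:
  fixes g :: "real \<Rightarrow> real"
  assumes cont: "continuous_on UNIV g" and per: "\<And>x. g (x + T) = g x" and "0 \<le> T"
  shows "integral {0..T} (\<lambda>x. g (x + c)) = integral {0..T} g"
proof -
  have "continuous_on UNIV (\<lambda>x. - g x)" by (intro continuous_intros cont)
  then obtain G where "\<And>x. (G has_real_derivative - (- g x)) (at x)"
    using antiderivative_UNIV[of "\<lambda>x. - g x" 0] by blast
  then have G: "(G has_real_derivative g x) (at x)" for x by simp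
  have shift: "((\<lambda>x. G (x + d)) has_real_derivative g (x + d)) (at x)" for d x
    using DERIV_shift[of G "g (x + d)" x d] G[of "x + d"] by simp
  have "\<forall>x. ((\<lambda>x. G (x + T) - G x) has_real_derivative 0) (at x)"
    using DERIV_diff[OF shift[of T] G] per by simp
  from DERIV_isconst_all[OF this, of c 0] have "G (T + c) - G (0 + c) = G T - G 0"
    by (simp add: add.commute)
  moreover have "((\<lambda>x. g (x + d)) has_integral G (T + d) - G (0 + d)) {0..T}" for d
    using \<open>0 \<le> T\<close> shift
    by (intro fundamental_theorem_of_calculus)
       (auto simp: has_real_derivative_iff_has_vector_derivative[symmetric]
          intro: has_field_derivative_at_within)
  from this[of c] this[of 0] have "integral {0..T} (\<lambda>x. g (x + c)) = G (T + c) - G (0 + c)"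
    "integral {0..T} g = G T - G 0"
    by (auto simp: integral_unique)
  ultimately show ?thesis by simp
qed

lemma unit_dir_add_2pi: "unit_dir (x + 2 * pi) = unit_dir x"
  by (simp add: unit_dir_def)

text \<open>
  With \<open>r = R * cos \<psi> - t\<close>, the point at distance \<open>r\<close> from the vertex along either branch lies on the
  circle of radius \<open>sqrt (s\<^sup>2 + t\<^sup>2)\<close>, where \<open>s = R * sin \<psi>\<close>, and its polar angle is \<open>\<phi>\<close> plus a rotation
  that does not depend on \<open>\<phi>\<close>. This is the rotational invariance of the transform.
\<close>

lemma ray_point_polar:
  fixes R \<phi> \<psi> t \<sigma> :: real
  assumes "\<sigma> = 1 \<or> \<sigma> = -1" and s: "0 < R * sin \<psi>"
  shows "R *\<^sub>R unit_dir \<phi> - (R * cos \<psi> - t) *\<^sub>R unit_dir (\<phi> - \<sigma> * \<psi>) =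
    sqrt ((R * sin \<psi>)\<^sup>2 + t\<^sup>2) *\<^sub>R unit_dir (\<phi> + \<sigma> * (pi / 2 - \<psi> - arctan (t / (R * sin \<psi>))))"
proof -
  define s where "s = R * sin \<psi>"
  define \<beta> where "\<beta> = arctan (t / s)"
  define \<rho> where "\<rho> = sqrt (s\<^sup>2 + t\<^sup>2)"
  define \<xi> where "\<xi> = \<phi> - \<sigma> * \<psi>"
  have "0 < s" using assms by (simp add: s_def)
  have "s\<^sup>2 + t\<^sup>2 = s\<^sup>2 * (1 + (t / s)\<^sup>2)"
    using \<open>0 < s\<close> by (simp add: power_divide distrib_left)
  then have \<rho>: "\<rho> = s * sqrt (1 + (t / s)\<^sup>2)"
    using \<open>0 < s\<close> by (simp add: \<rho>_def real_sqrt_mult)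
  have "sqrt (1 + (t / s)\<^sup>2) > 0" by (simp add: add_pos_nonneg)
  then have cos: "\<rho> * cos \<beta> = s" and sin: "\<rho> * sin \<beta> = t"
    using \<open>0 < s\<close> by (simp_all add: \<rho> \<beta>_def cos_arctan sin_arctan)
  have ray: "R *\<^sub>R unit_dir (\<xi> + \<sigma> * \<psi>) - (R * cos \<psi> - t) *\<^sub>R unit_dir \<xi> =
      vector [t * cos \<xi> - \<sigma> * s * sin \<xi>, t * sin \<xi> + \<sigma> * s * cos \<xi>]"
    using assms(1)
    by (auto simp: unit_dir_def vec_eq_iff forall_2 s_def cos_add sin_add cos_diff sin_diff algebra_simps)
  have "\<rho> *\<^sub>R unit_dir (\<xi> + \<sigma> * (pi / 2 - \<beta>)) =
      vector [(\<rho> * sin \<beta>) * cos \<xi> - \<sigma> * (\<rho> * cos \<beta>) * sin \<xi>,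
              (\<rho> * sin \<beta>) * sin \<xi> + \<sigma> * (\<rho> * cos \<beta>) * cos \<xi>]"
    using assms(1)
    by (auto simp: unit_dir_def vec_eq_iff forall_2 cos_add sin_add cos_diff sin_diff algebra_simps)
  also have "\<dots> = R *\<^sub>R unit_dir (\<xi> + \<sigma> * \<psi>) - (R * cos \<psi> - t) *\<^sub>R unit_dir \<xi>"
    unfolding ray cos sin ..
  finally show ?thesis
    unfolding s_def[symmetric] \<rho>_def[symmetric] \<beta>_def[symmetric]
    by (simp add: \<xi>_def algebra_simps)
qed

text \<open>
  The vertex lies on the circle of radius \<open>R\<close>, so after length \<open>2 * R\<close> a ray has left the disc.
\<close>

lemma vline_transform_eq_integral:
  fixes f :: "real^2 \<Rightarrow> real"
  assumes cont: "continuous_on UNIV f" and vanish: "\<And>x. R \<le> norm x \<Longrightarrow> f x = 0" and "0 < R"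
  shows "vline_transform R \<mu> f \<phi> \<psi> =
    integral {0..2 * R} (\<lambda>r. f (R *\<^sub>R unit_dir \<phi> - r *\<^sub>R unit_dir (\<phi> - \<psi>)) * exp (- \<mu> * r)) +
    integral {0..2 * R} (\<lambda>r. f (R *\<^sub>R unit_dir \<phi> - r *\<^sub>R unit_dir (\<phi> + \<psi>)) * exp (- \<mu> * r))"
proof -
  have "(LBINT r:{0..}. f (R *\<^sub>R unit_dir \<phi> - r *\<^sub>R unit_dir \<theta>) * exp (- \<mu> * r)) =
      integral {0..2 * R} (\<lambda>r. f (R *\<^sub>R unit_dir \<phi> - r *\<^sub>R unit_dir \<theta>) * exp (- \<mu> * r))" for \<theta>
  proof -
    let ?h = "\<lambda>r. f (R *\<^sub>R unit_dir \<phi> - r *\<^sub>R unit_dir \<theta>) * exp (- \<mu> * r)"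
    have "?h r = 0" if "2 * R < r" for r
    proof -
      have "r - R \<le> norm (R *\<^sub>R unit_dir \<phi> - r *\<^sub>R unit_dir \<theta>)"
        using norm_triangle_ineq2[of "r *\<^sub>R unit_dir \<theta>" "R *\<^sub>R unit_dir \<phi>"] that \<open>0 < R\<close>
        by (simp add: norm_minus_commute)
      then show ?thesis using that by (simp add: vanish)
    qed
    then have "(LBINT r:{0..}. ?h r) = (LBINT r:{0..2 * R}. ?h r)"
      unfolding set_lebesgue_integral_def
      by (intro Bochner_Integration.integral_cong) (auto simp: indicator_def not_le)
    also have "\<dots> = integral {0..2 * R} ?h"
      by (intro set_borel_integral_eq_integral borel_integrable_atLeastAtMost' continuous_intros
            continuous_on_compose2[OF cont]) auto
    finally show ?thesis .
  qed
  then show ?thesis by (simp add: vline_transform_def)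
qed

text \<open>
  The branches rotate the circle by opposite angles. In the sum of the two
  contributions the sine terms cancel, so that a single moment of \<open>f\<close> remains.
\<close>

lemma circle_moment_rotated_pair:
  fixes f :: "real^2 \<Rightarrow> real" and n :: int
  assumes cont: "continuous_on UNIV f"
  shows "integral {0..2 * pi} (\<lambda>\<phi>. f (\<rho> *\<^sub>R unit_dir (\<phi> + \<alpha>)) * cos (real_of_int n * \<phi> - \<gamma>)) +
      integral {0..2 * pi} (\<lambda>\<phi>. f (\<rho> *\<^sub>R unit_dir (\<phi> - \<alpha>)) * cos (real_of_int n * \<phi> - \<gamma>)) =
    2 * cos (real_of_int n * \<alpha>) * circle_moment f (\<lambda>\<theta>. cos (real_of_int n * \<theta> - \<gamma>)) \<rho>"
proof -
  have contf: "continuous_on S (\<lambda>\<theta>. f (\<rho> *\<^sub>R unit_dir (\<theta> + \<alpha>')))" for S :: "real set" and \<alpha>'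
    by (intro continuous_on_compose2[OF cont] continuous_intros) auto
  have rot: "integral {0..2 * pi} (\<lambda>\<phi>. f (\<rho> *\<^sub>R unit_dir (\<phi> + \<alpha>')) * cos (real_of_int n * \<phi> - \<gamma>)) =
      integral {0..2 * pi} (\<lambda>\<theta>. f (\<rho> *\<^sub>R unit_dir \<theta>) * cos (real_of_int n * (\<theta> - \<alpha>') - \<gamma>))" for \<alpha>'
  proof -
    let ?g = "\<lambda>\<theta>. f (\<rho> *\<^sub>R unit_dir \<theta>) * cos (real_of_int n * (\<theta> - \<alpha>') - \<gamma>)"
    have "integral {0..2 * pi} (\<lambda>\<phi>. ?g (\<phi> + \<alpha>')) = integral {0..2 * pi} ?g"
    proof (rule integral_periodic_shift)
      show "continuous_on UNIV ?g"
        using contf[of UNIV 0] by (intro continuous_intros) simp_all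
      show "?g (\<theta> + 2 * pi) = ?g \<theta>" for \<theta>
      proof -
        have "cos (real_of_int n * (\<theta> + 2 * pi - \<alpha>') - \<gamma>) = cos ((real_of_int n * (\<theta> - \<alpha>') - \<gamma>) + 2 * pi * real_of_int n)"
          by (simp add: algebra_simps)
        also have "\<dots> = cos (real_of_int n * (\<theta> - \<alpha>') - \<gamma>)"
          by (simp add: cos_add)
        finally show ?thesis by (simp add: unit_dir_add_2pi)
      qed
    qed simp
    then show ?thesis by simp
  qed
  have "integral {0..2 * pi} (\<lambda>\<phi>. f (\<rho> *\<^sub>R unit_dir (\<phi> + \<alpha>)) * cos (real_of_int n * \<phi> - \<gamma>)) +
      integral {0..2 * pi} (\<lambda>\<phi>. f (\<rho> *\<^sub>R unit_dir (\<phi> + - \<alpha>)) * cos (real_of_int n * \<phi> - \<gamma>)) =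
    integral {0..2 * pi} (\<lambda>\<theta>. f (\<rho> *\<^sub>R unit_dir \<theta>) * cos (real_of_int n * (\<theta> - \<alpha>) - \<gamma>) +
      f (\<rho> *\<^sub>R unit_dir \<theta>) * cos (real_of_int n * (\<theta> - - \<alpha>) - \<gamma>))"
    unfolding rot using contf[of _ 0]
    by (intro integral_add[symmetric] integrable_continuous_interval continuous_intros) simp_all
  also have "\<dots> = integral {0..2 * pi} (\<lambda>\<theta>. 2 * cos (real_of_int n * \<alpha>) * (f (\<rho> *\<^sub>R unit_dir \<theta>) * cos (real_of_int n * \<theta> - \<gamma>)))"
  proof (rule integral_cong)
    fix \<theta>
    have "cos (real_of_int n * (\<theta> - \<alpha>) - \<gamma>) + cos (real_of_int n * (\<theta> - - \<alpha>) - \<gamma>)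
        = cos ((real_of_int n * \<theta> - \<gamma>) - real_of_int n * \<alpha>) + cos ((real_of_int n * \<theta> - \<gamma>) + real_of_int n * \<alpha>)"
      by (simp add: algebra_simps)
    also have "\<dots> = 2 * cos (real_of_int n * \<alpha>) * cos (real_of_int n * \<theta> - \<gamma>)"
      unfolding cos_add cos_diff[of "real_of_int n * \<theta> - \<gamma>" "real_of_int n * \<alpha>"] by simp
    finally show "f (\<rho> *\<^sub>R unit_dir \<theta>) * cos (real_of_int n * (\<theta> - \<alpha>) - \<gamma>) +
      f (\<rho> *\<^sub>R unit_dir \<theta>) * cos (real_of_int n * (\<theta> - - \<alpha>) - \<gamma>) =
      2 * cos (real_of_int n * \<alpha>) * (f (\<rho> *\<^sub>R unit_dir \<theta>) * cos (real_of_int n * \<theta> - \<gamma>))"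
      by (simp only: distrib_left[symmetric] mult_ac)
  qed
  finally show ?thesis by (simp add: circle_moment_def)
qed

text \<open>
  Integrating the transform against \<open>cos (n * \<phi> - \<gamma>)\<close> and exchanging the integrals reduces the ray
  integrals to the moments of \<open>f\<close>. The part of the line beyond the vertex and the part beyond \<open>2 * R\<close> lie
  outside the disc, so the line can be cut symmetrically at \<open>- R\<close> and \<open>R\<close> before folding it.
\<close>

lemma circle_moment_abel_equation:
  fixes f :: "real^2 \<Rightarrow> real" and n :: int and R \<mu> \<gamma> \<psi> :: real
  defines "a \<equiv> circle_moment f (\<lambda>\<theta>. cos (real_of_int n * \<theta> - \<gamma>))"
    and "k \<equiv> branch_kernel \<mu> n (pi / 2 - \<psi>) (R * sin \<psi>)"
  assumes f: "smooth f" and vanish: "\<And>x. R \<le> norm x \<Longrightarrow> f x = 0" and "0 < R"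
    and \<psi>: "0 < \<psi>" "\<psi> < pi / 2"
    and V: "\<And>\<phi>. 0 \<le> \<phi> \<Longrightarrow> \<phi> < 2 * pi \<Longrightarrow> vline_transform R \<mu> f \<phi> \<psi> = 0"
  shows "integral {0..R} (\<lambda>t. a (sqrt ((R * sin \<psi>)\<^sup>2 + t\<^sup>2)) * (k t + k (- t))) = 0"
proof -
  define c where "c = R * cos \<psi>"
  define s where "s = R * sin \<psi>"
  define q where "q t = a (sqrt (s\<^sup>2 + t\<^sup>2)) * k t" for t
  define P where "P \<theta> \<phi> r = f (R *\<^sub>R unit_dir \<phi> - r *\<^sub>R unit_dir (\<phi> + \<theta>)) * exp (- \<mu> * r) * cos (real_of_int n * \<phi> - \<gamma>)"
    for \<theta> \<phi> r
  define J where "J \<theta> r = integral {0..2 * pi} (\<lambda>\<phi>. P \<theta> \<phi> r)" for \<theta> r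
  have "0 < s" "0 < c"
    using \<psi> \<open>0 < R\<close> sin_gt_zero[of \<psi>] cos_gt_zero[of \<psi>] by (auto simp: s_def c_def)
  have "c \<le> R" using \<open>0 < R\<close> by (simp add: c_def)
  have sc: "s\<^sup>2 + c\<^sup>2 = R\<^sup>2"
    by (simp add: s_def c_def power_mult_distrib distrib_left[symmetric])
  have contf: "continuous_on UNIV f" using f by (rule smooth_imp_continuous_on)
  have contP: "continuous_on S (\<lambda>(\<phi>, r). P \<theta> \<phi> r)" for S \<theta>
    unfolding P_def case_prod_beta
    by (intro continuous_intros continuous_on_compose2[OF contf]) auto
  have contP1: "continuous_on S (P \<theta> \<phi>)" for S \<theta> \<phi>
    unfolding P_def by (intro continuous_intros continuous_on_compose2[OF contf]) auto
  have conta: "continuous_on UNIV a"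
    unfolding a_def by (intro continuous_on_moment_sum moment_sum.moment f continuous_intros)
  have contq: "continuous_on S q" for S
    unfolding q_def k_def branch_kernel_def s_def[symmetric] using \<open>0 < s\<close>
    by (intro continuous_intros continuous_on_compose2[OF conta]) auto
  have contJ: "continuous_on {0..2 * R} (J \<theta>)" for \<theta>
  proof -
    have "continuous_on ({0..2 * R} \<times> cbox 0 (2 * pi)) (\<lambda>(r, \<phi>). P \<theta> \<phi> r)"
      unfolding P_def case_prod_beta
      by (intro continuous_intros continuous_on_compose2[OF contf]) auto
    from integral_continuous_on_param[OF this] show ?thesis
      unfolding J_def cbox_interval .
  qed
  have a0: "a \<rho> = 0" if "R \<le> \<rho>" for \<rho>
  proof -
    have "f (\<rho> *\<^sub>R unit_dir \<theta>) = 0" for \<theta> using that \<open>0 < R\<close> by (intro vanish) simp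
    then show ?thesis by (simp add: a_def circle_moment_def)
  qed
  have q0: "q t = 0" if "t \<notin> {- c..c}" for t
  proof -
    have "c \<le> \<bar>t\<bar>" using that by auto
    then have "c\<^sup>2 \<le> t\<^sup>2" using \<open>0 < c\<close> by (metis abs_le_square_iff abs_of_pos)
    then have "R\<^sup>2 \<le> s\<^sup>2 + t\<^sup>2" using sc by linarith
    then have "R \<le> sqrt (s\<^sup>2 + t\<^sup>2)" by (rule real_le_rsqrt)
    then show ?thesis by (simp add: q_def a0)
  qed
  \<comment> \<open>The transform is only known to vanish for \<open>\<phi> < 2 * pi\<close>; the endpoint is a null set.\<close>
  have "0 = integral {0..2 * pi} (\<lambda>\<phi>. vline_transform R \<mu> f \<phi> \<psi> * cos (real_of_int n * \<phi> - \<gamma>))"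
  proof -
    have "integral {0..2 * pi} (\<lambda>\<phi>. vline_transform R \<mu> f \<phi> \<psi> * cos (real_of_int n * \<phi> - \<gamma>)) = integral {0..2 * pi} (\<lambda>\<phi>. 0)"
      by (rule integral_spike[of "{2 * pi}"]) (auto simp: V)
    then show ?thesis by simp
  qed
  also have "\<dots> = integral {0..2 * pi} (\<lambda>\<phi>. integral {0..2 * R} (P (- \<psi>) \<phi>) + integral {0..2 * R} (P \<psi> \<phi>))"
  proof (rule integral_cong)
    fix \<phi>
    have "vline_transform R \<mu> f \<phi> \<psi> =
      integral {0..2 * R} (\<lambda>r. f (R *\<^sub>R unit_dir \<phi> - r *\<^sub>R unit_dir (\<phi> - \<psi>)) * exp (- \<mu> * r)) +
      integral {0..2 * R} (\<lambda>r. f (R *\<^sub>R unit_dir \<phi> - r *\<^sub>R unit_dir (\<phi> + \<psi>)) * exp (- \<mu> * r))"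
      by (rule vline_transform_eq_integral[OF contf]) (use vanish \<open>0 < R\<close> in auto)
    then show "vline_transform R \<mu> f \<phi> \<psi> * cos (real_of_int n * \<phi> - \<gamma>) =
        integral {0..2 * R} (P (- \<psi>) \<phi>) + integral {0..2 * R} (P \<psi> \<phi>)"
      unfolding P_def by (simp add: distrib_right)
  qed
  also have "\<dots> = integral {0..2 * pi} (\<lambda>\<phi>. integral {0..2 * R} (P (- \<psi>) \<phi>)) +
      integral {0..2 * pi} (\<lambda>\<phi>. integral {0..2 * R} (P \<psi> \<phi>))"
  proof -
    have "(\<lambda>\<phi>. integral {0..2 * R} (P \<theta> \<phi>)) integrable_on {0..2 * pi}" for \<theta>
      using integral_continuous_on_param[OF contP, of "{0..2 * pi}" 0 "2 * R" \<theta>]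
      by (intro integrable_continuous_interval) simp
    then show ?thesis by (intro integral_add)
  qed
  also have "\<dots> = integral {0..2 * R} (J (- \<psi>)) + integral {0..2 * R} (J \<psi>)"
    using integral_swap_continuous[OF contP, of 0 "2 * pi" 0 "2 * R"] by (simp add: J_def[abs_def])
  also have "\<dots> = integral {0..2 * R} (\<lambda>r. J (- \<psi>) r + J \<psi> r)"
    by (intro integral_add[symmetric] integrable_continuous_interval contJ)
  also have "\<dots> = integral {0..2 * R} (\<lambda>r. 2 * exp (- \<mu> * c) * q (c - r))"
  proof (rule integral_cong)
    fix r assume "r \<in> {0..2 * R}"
    define t where "t = c - r"
    define \<rho> where "\<rho> = sqrt (s\<^sup>2 + t\<^sup>2)"
    define \<alpha> where "\<alpha> = pi / 2 - \<psi> - arctan (t / s)"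
    have r: "r = c - t" by (simp add: t_def)
    have pt: "R *\<^sub>R unit_dir \<phi> - r *\<^sub>R unit_dir (\<phi> + - \<psi>) = \<rho> *\<^sub>R unit_dir (\<phi> + \<alpha>)"
      "R *\<^sub>R unit_dir \<phi> - r *\<^sub>R unit_dir (\<phi> + \<psi>) = \<rho> *\<^sub>R unit_dir (\<phi> - \<alpha>)" for \<phi>
      using ray_point_polar[of 1 R \<psi> \<phi> t] ray_point_polar[of "-1" R \<psi> \<phi> t] \<open>0 < s\<close>
      unfolding r c_def \<rho>_def \<alpha>_def s_def by (simp_all add: algebra_simps)
    have "J (- \<psi>) r + J \<psi> r = exp (- \<mu> * r) *
        (integral {0..2 * pi} (\<lambda>\<phi>. f (\<rho> *\<^sub>R unit_dir (\<phi> + \<alpha>)) * cos (real_of_int n * \<phi> - \<gamma>)) +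
         integral {0..2 * pi} (\<lambda>\<phi>. f (\<rho> *\<^sub>R unit_dir (\<phi> - \<alpha>)) * cos (real_of_int n * \<phi> - \<gamma>)))"
      unfolding J_def P_def pt distrib_left
      by (simp only: integral_mult_right[symmetric] mult_ac)
    also have "\<dots> = exp (- \<mu> * r) * (2 * cos (real_of_int n * \<alpha>) * a \<rho>)"
      unfolding circle_moment_rotated_pair[OF contf] a_def ..
    also have "exp (- \<mu> * r) = exp (- \<mu> * c) * exp (\<mu> * t)"
      by (simp add: r mult_exp_exp algebra_simps)
    finally show "J (- \<psi>) r + J \<psi> r = 2 * exp (- \<mu> * c) * q (c - r)"
      unfolding q_def k_def branch_kernel_def t_def[symmetric] s_def[symmetric] \<rho>_def[symmetric] \<alpha>_def[symmetric]
      by (simp only: mult_ac)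
  qed
  also have "\<dots> = 2 * exp (- \<mu> * c) * integral {0..2 * R} (\<lambda>r. q (c - r))"
    by simp
  also have "integral {0..2 * R} (\<lambda>r. q (c - r)) = integral {c - 2 * R..c} q"
    using integral_shift_real_ivl[of "- c" "- c" "2 * R - c" "\<lambda>x. q (- x)"]
      Henstock_Kurzweil_Integration.integral_reflect_real[of "c" "c - 2 * R" q] by simp
  also have "integral {c - 2 * R..c} q = integral {- R..R} q"
  proof -
    have I: "(q has_integral integral {- c..c} q) {- c..c}"
      by (intro integrable_integral integrable_continuous_interval contq)
    have "(q has_integral integral {- c..c} q) {c - 2 * R..c}"
      "(q has_integral integral {- c..c} q) {- R..R}"
      using \<open>c \<le> R\<close> \<open>0 < c\<close> by (auto intro!: has_integral_on_superset[OF I] q0)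
    then show ?thesis by (simp add: integral_unique)
  qed
  finally have "integral {- R..R} q = 0" by simp
  moreover have "integral {- R..R} q = integral {- R..0} q + integral {0..R} q"
    using \<open>0 < R\<close>
    by (intro Henstock_Kurzweil_Integration.integral_combine[symmetric] integrable_continuous_interval contq) auto
  moreover have "integral {- R..0} q = integral {0..R} (\<lambda>t. q (- t))"
    using Henstock_Kurzweil_Integration.integral_reflect_real[of R 0 "\<lambda>t. q (- t)"] by simp
  moreover have "integral {0..R} (\<lambda>t. q t + q (- t)) = integral {0..R} q + integral {0..R} (\<lambda>t. q (- t))"
    by (intro integral_add integrable_continuous_interval contq continuous_on_compose2[OF contq[of UNIV]]
          continuous_intros) auto
  ultimately show ?thesis
    unfolding s_def[symmetric] by (simp add: q_def distrib_left)
qed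

text \<open>
  The smallest \<open>B\<close> beyond which the moment vanishes, as a function of the squared radius, cannot be
  positive: local uniqueness would push it further down.
\<close>

lemma circle_moment_eq_0:
  fixes f :: "real^2 \<Rightarrow> real" and n :: int and R R' \<mu> \<gamma> :: real
  defines "a \<equiv> circle_moment f (\<lambda>\<theta>. cos (real_of_int n * \<theta> - \<gamma>))"
  assumes f: "smooth f" and vanish: "\<And>x. R' \<le> norm x \<Longrightarrow> f x = 0" and R': "0 < R'" "R' < R"
    and V: "\<And>\<phi> \<psi>. 0 \<le> \<phi> \<Longrightarrow> \<phi> < 2 * pi \<Longrightarrow> 0 < \<psi> \<Longrightarrow> \<psi> < pi / 2 \<Longrightarrow> vline_transform R \<mu> f \<phi> \<psi> = 0"
    and "0 < \<rho>"
  shows "a \<rho> = 0"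
proof -
  define b where "b q = a (sqrt q)" for q
  define K where "K p t = branch_kernel \<mu> n (arccos (sqrt p / R)) (sqrt p) t +
      branch_kernel \<mu> n (arccos (sqrt p / R)) (sqrt p) (- t)" for p t
  have "0 < R" using R' by simp
  have ms: "moment_sum a"
    unfolding a_def by (intro moment_sum.moment f continuous_intros)
  have conta: "continuous_on UNIV a" by (rule continuous_on_moment_sum[OF ms])
  have contb: "continuous_on UNIV b"
    unfolding b_def by (intro continuous_on_compose2[OF conta] continuous_intros) auto
  have a0: "a r = 0" if "R' \<le> r" for r
  proof -
    have "f (r *\<^sub>R unit_dir \<theta>) = 0" for \<theta> using that R' by (intro vanish) simp
    then show ?thesis by (simp add: a_def circle_moment_def)
  qed
  have b0: "b q = 0" if "R'\<^sup>2 \<le> q" for q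
    unfolding b_def using that by (intro a0 real_le_rsqrt)
  have eq: "integral {0..R} (\<lambda>t. b (p + t\<^sup>2) * K p t) = 0" if p: "0 < p" "p < R\<^sup>2" for p
  proof -
    define \<psi> where "\<psi> = arcsin (sqrt p / R)"
    have sp: "0 < sqrt p / R" "sqrt p / R < 1"
      using p \<open>0 < R\<close> real_sqrt_less_mono[OF p(2)] by auto
    have "0 < \<psi>" "\<psi> < pi / 2"
      using sp arcsin_less_arcsin[of 0 "sqrt p / R"] arcsin_lt_bounded[of "sqrt p / R"]
      by (auto simp: \<psi>_def)
    have s: "R * sin \<psi> = sqrt p"
      using sp \<open>0 < R\<close> by (simp add: \<psi>_def)
    have \<alpha>: "pi / 2 - \<psi> = arccos (sqrt p / R)"
      using sp arcsin_arccos_eq[of "sqrt p / R"] by (simp add: \<psi>_def)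
    have "integral {0..R} (\<lambda>t. a (sqrt ((sqrt p)\<^sup>2 + t\<^sup>2)) * K p t) = 0"
      using circle_moment_abel_equation[OF f _ \<open>0 < R\<close> \<open>0 < \<psi>\<close> \<open>\<psi> < pi / 2\<close>, of \<mu> n \<gamma>]
        vanish R' V \<open>0 < \<psi>\<close> \<open>\<psi> < pi / 2\<close>
      unfolding s \<alpha> a_def K_def by fastforce
    then show ?thesis using p by (simp add: b_def)
  qed
  have K0: "K p 0 = 2 * cos (real_of_int n * arccos (sqrt p / R))" for p
    by (simp add: K_def branch_kernel_def)
  have kernel: "\<exists>C K'. 0 \<le> C \<and> (\<forall>p\<ge>p1. (\<forall>t. (K p has_real_derivative K' p t) (at t)) \<and>
      (\<forall>t. 0 \<le> t \<longrightarrow> t \<le> R \<longrightarrow> \<bar>K' p t\<bar> \<le> C * t))" if "0 < p1" for p1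
  proof -
    have "0 < sqrt p1" using that by simp
    from branch_kernel_derivatives[OF this, of \<mu> n R] obtain C where C: "0 \<le> C" and
      D: "\<forall>\<alpha>. \<forall>s\<ge>sqrt p1. \<exists>g' g''.
       (\<forall>t. (branch_kernel \<mu> n \<alpha> s has_real_derivative g' t) (at t)) \<and>
       (\<forall>t. (g' has_real_derivative g'' t) (at t)) \<and> (\<forall>t. \<bar>t\<bar> \<le> R \<longrightarrow> \<bar>g'' t\<bar> \<le> C)"
      by blast
    have "\<exists>k'. (\<forall>t. (K p has_real_derivative k' t) (at t)) \<and>
        (\<forall>t. 0 \<le> t \<longrightarrow> t \<le> R \<longrightarrow> \<bar>k' t\<bar> \<le> 2 * C * t)" if "p1 \<le> p" for p
    proof -
      have "sqrt p1 \<le> sqrt p" using that by simp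
      with D obtain g' g'' where
        "\<And>t. (branch_kernel \<mu> n (arccos (sqrt p / R)) (sqrt p) has_real_derivative g' t) (at t)"
        "\<And>t. (g' has_real_derivative g'' t) (at t)" "\<And>t. \<bar>t\<bar> \<le> R \<Longrightarrow> \<bar>g'' t\<bar> \<le> C"
        by (meson order_refl)
      from even_part_second_order[OF this] show ?thesis
        unfolding K_def[abs_def] by (intro exI[of _ "\<lambda>t. g' t - g' (- t)"]) blast
    qed
    then have "\<exists>K'. \<forall>p\<ge>p1. (\<forall>t. (K p has_real_derivative K' p t) (at t)) \<and>
        (\<forall>t. 0 \<le> t \<longrightarrow> t \<le> R \<longrightarrow> \<bar>K' p t\<bar> \<le> 2 * C * t)" by metis
    then show ?thesis using C by (intro exI[of _ "2 * C"]) auto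
  qed
  have flat: "\<exists>M. \<forall>q\<in>{p1..B}. \<bar>b q\<bar> \<le> M * (B - q) ^ n'"
    if "0 < p1" "0 < B" and van: "\<And>q. B \<le> q \<Longrightarrow> b q = 0" for p1 B n'
  proof -
    have "a r = 0" if "sqrt B \<le> r" for r
    proof -
      have "0 \<le> r" using that \<open>0 < B\<close> by (meson less_imp_le order_trans real_sqrt_ge_zero)
      then show ?thesis
        using that van[of "r\<^sup>2"] \<open>0 < B\<close> by (simp add: b_def sqrt_le_D)
    qed
    then obtain M where M: "M \<ge> 0" "\<And>r. r \<in> {0..sqrt B} \<Longrightarrow> \<bar>a r\<bar> \<le> M * (sqrt B - r) ^ n'"
      using moment_sum_flat[OF ms, of "sqrt B" 0 n'] by blast
    have "\<bar>b q\<bar> \<le> M / sqrt B ^ n' * (B - q) ^ n'" if q: "q \<in> {p1..B}" for q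
    proof -
      have "0 \<le> q" using q \<open>0 < p1\<close> by simp
      have "(sqrt B - sqrt q) * sqrt B \<le> (sqrt B - sqrt q) * (sqrt B + sqrt q)"
        using q \<open>0 \<le> q\<close> by (intro mult_left_mono) auto
      also have "\<dots> = B - q"
        using \<open>0 < B\<close> \<open>0 \<le> q\<close> by (simp add: algebra_simps)
      finally have le: "sqrt B - sqrt q \<le> (B - q) / sqrt B"
        using \<open>0 < B\<close> by (simp add: pos_le_divide_eq)
      have "\<bar>b q\<bar> \<le> M * (sqrt B - sqrt q) ^ n'"
        unfolding b_def using q \<open>0 \<le> q\<close> by (intro M) auto
      also have "\<dots> \<le> M * ((B - q) / sqrt B) ^ n'"
        using le q M(1) by (intro mult_left_mono power_mono) auto
      finally show ?thesis by (simp add: power_divide)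
    qed
    then show ?thesis by blast
  qed
  define S where "S = {B. 0 < B \<and> (\<forall>q\<ge>B. b q = 0)}"
  define B where "B = Inf S"
  have "R'\<^sup>2 \<in> S" using b0 R' by (simp add: S_def)
  have bdd: "bdd_below S" by (rule bdd_belowI[of _ 0]) (auto simp: S_def)
  have "B \<le> R'\<^sup>2" unfolding B_def by (rule cInf_lower[OF \<open>R'\<^sup>2 \<in> S\<close> bdd])
  have beyond: "b q = 0" if "B < q" for q
  proof -
    have "S \<noteq> {}" using \<open>R'\<^sup>2 \<in> S\<close> by auto
    moreover have "Inf S < q" using that by (simp add: B_def)
    ultimately obtain x where "x \<in> S" "x < q" using cInf_lessD by metis
    then show ?thesis by (simp add: S_def)
  qed
  have vanB: "b q = 0" if "B \<le> q" for q
  proof (rule continuous_constant_on_closure[where f = b and S = "{B<..}"])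
    show "continuous_on (closure {B<..}) b" using contb continuous_on_subset by blast
    show "q \<in> closure {B<..}" using that by (simp add: closure_greaterThan)
  qed (use beyond in auto)
  have "B \<le> 0"
  proof (rule ccontr)
    assume "\<not> B \<le> 0"
    then have "0 < B" by simp
    have "R'\<^sup>2 < R\<^sup>2" using R' by (intro power_strict_mono) auto
    with \<open>B \<le> R'\<^sup>2\<close> have "B < R\<^sup>2" by simp
    obtain c \<delta> where c: "0 < c" "0 < \<delta>"
      "\<And>p. B - \<delta> < p \<Longrightarrow> p < B \<Longrightarrow> c * (B - p) \<le> \<bar>cos (real_of_int n * arccos (sqrt p / R))\<bar>"
    proof -
      obtain D where "((\<lambda>p. cos (real_of_int n * arccos (sqrt p / R))) has_real_derivative D) (at B)"
        "cos (real_of_int n * arccos (sqrt B / R)) \<noteq> 0 \<or> D \<noteq> 0"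
        using cos_multiple_arccos_simple_zero[OF \<open>0 < R\<close> \<open>0 < B\<close> \<open>B < R\<^sup>2\<close>] by blast
      from linear_lower_bound_at_simple_zero[OF this] that show ?thesis by blast
    qed
    \<comment> \<open>Staying above \<open>B / 2\<close> keeps the kernel bounds uniform.\<close>
    define p1 where "p1 = max (B - \<delta> / 2) (B / 2)"
    have p1: "0 < p1" "p1 < B" "B - \<delta> < p1" using \<open>0 < B\<close> c by (auto simp: p1_def)
    obtain C K' where "0 \<le> C" and K': "\<And>p t. p1 \<le> p \<Longrightarrow> (K p has_real_derivative K' p t) (at t)"
      "\<And>p t. p1 \<le> p \<Longrightarrow> 0 \<le> t \<Longrightarrow> t \<le> R \<Longrightarrow> \<bar>K' p t\<bar> \<le> C * t"
      using kernel[OF p1(1)] by blast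
    have "b q = 0" if "p1 < q" for q
    proof (rule generalized_abel_local_uniqueness[where b = b and L = R and B = B and K = K and K' = K' and C = C and c = "2 * c" and ?p1.0 = p1])
      show "2 * c * (B - p) \<le> \<bar>K p 0\<bar>" if "p1 \<le> p" "p < B" for p
        using c(3)[of p] that p1 by (simp add: K0 abs_mult)
      show "integral {0..R} (\<lambda>t. b (p + t\<^sup>2) * K p t) = 0" if "p1 \<le> p" "p < B" for p
        using that p1 \<open>B < R\<^sup>2\<close> by (intro eq) auto
      show "\<exists>M. \<forall>q\<in>{p1..B}. \<bar>b q\<bar> \<le> M * (B - q) ^ n" for n
        by (rule flat[OF p1(1) \<open>0 < B\<close> vanB])
    qed (use that K' contb vanB \<open>0 < R\<close> \<open>B < R\<^sup>2\<close> p1 c \<open>0 \<le> C\<close> in auto)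
    then have "(p1 + B) / 2 \<in> S" using p1 by (auto simp: S_def)
    from cInf_lower[OF this bdd] p1 show False by (simp add: B_def)
  qed
  then have "b (\<rho>\<^sup>2) = 0" using vanB[of "\<rho>\<^sup>2"] by (meson order_trans zero_le_power2)
  then show ?thesis using \<open>0 < \<rho>\<close> by (simp add: b_def)
qed

section \<open>Fourier completeness on circles\<close>

text \<open>
  Allowing arbitrary integers \<open>n\<close> and arbitrary phases covers sine, cosine and constants by one
  constructor, and makes the product formula for cosines free of case distinctions.
\<close>

inductive trig_poly :: "(real \<Rightarrow> real) \<Rightarrow> bool" where
  wave: "trig_poly (\<lambda>\<theta>. c * cos (real_of_int n * \<theta> - \<gamma>))"
| add: "trig_poly v \<Longrightarrow> trig_poly w \<Longrightarrow> trig_poly (\<lambda>\<theta>. v \<theta> + w \<theta>)"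

lemma trig_poly_wave_mult:
  "trig_poly w \<Longrightarrow> trig_poly (\<lambda>\<theta>. (c * cos (real_of_int n * \<theta> - \<gamma>)) * w \<theta>)"
proof (induction rule: trig_poly.induct)
  case (wave d m \<delta>)
  have "(\<lambda>\<theta>. (c * cos (real_of_int n * \<theta> - \<gamma>)) * (d * cos (real_of_int m * \<theta> - \<delta>))) =
    (\<lambda>\<theta>. (c * d / 2) * cos (real_of_int (n + m) * \<theta> - (\<gamma> + \<delta>)) +
         (c * d / 2) * cos (real_of_int (n - m) * \<theta> - (\<gamma> - \<delta>)))"
  proof
    fix \<theta>
    have "cos (real_of_int (n + m) * \<theta> - (\<gamma> + \<delta>)) + cos (real_of_int (n - m) * \<theta> - (\<gamma> - \<delta>))
      = cos ((real_of_int n * \<theta> - \<gamma>) + (real_of_int m * \<theta> - \<delta>)) +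
        cos ((real_of_int n * \<theta> - \<gamma>) - (real_of_int m * \<theta> - \<delta>))"
      by (simp add: algebra_simps)
    also have "\<dots> = 2 * (cos (real_of_int n * \<theta> - \<gamma>) * cos (real_of_int m * \<theta> - \<delta>))"
      unfolding cos_add cos_diff[of "real_of_int n * \<theta> - \<gamma>" "real_of_int m * \<theta> - \<delta>"] by simp
    finally show "(c * cos (real_of_int n * \<theta> - \<gamma>)) * (d * cos (real_of_int m * \<theta> - \<delta>)) =
      (c * d / 2) * cos (real_of_int (n + m) * \<theta> - (\<gamma> + \<delta>)) +
         (c * d / 2) * cos (real_of_int (n - m) * \<theta> - (\<gamma> - \<delta>))"
      unfolding distrib_left[symmetric] by simp
  qed
  then show ?case by (simp only: trig_poly.intros)
next
  case (add v w)
  then show ?case by (simp only: distrib_left trig_poly.add)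
qed

lemma trig_poly_mult: "trig_poly v \<Longrightarrow> trig_poly w \<Longrightarrow> trig_poly (\<lambda>\<theta>. v \<theta> * w \<theta>)"
proof (induction rule: trig_poly.induct)
  case (add u v)
  then show ?case by (simp only: distrib_right trig_poly.add)
qed (rule trig_poly_wave_mult)

lemma trig_poly_const: "trig_poly (\<lambda>_. c)"
  using trig_poly.wave[of c 0 0] by simp

lemma trig_poly_real_polynomial_on_circle:
  fixes P :: "real^2 \<Rightarrow> real"
  assumes "real_polynomial_function P"
  shows "trig_poly (\<lambda>\<theta>. P (\<rho> *\<^sub>R unit_dir \<theta>))"
  using assms
proof induction
  case (linear P)
  then have "linear P" by (rule bounded_linear.linear)
  then have "(\<lambda>\<theta>. P (\<rho> *\<^sub>R unit_dir \<theta>)) = (\<lambda>\<theta>. \<rho> * P (axis 1 1) * cos (real_of_int 1 * \<theta> - 0) +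
      \<rho> * P (axis 2 1) * cos (real_of_int 1 * \<theta> - pi / 2))"
    by (simp add: unit_dir_eq_axis linear_add linear_cmul cos_diff algebra_simps)
  then show ?case by (simp only: trig_poly.intros)
qed (auto intro: trig_poly_const trig_poly.add trig_poly_mult)

lemma continuous_on_trig_poly: "trig_poly w \<Longrightarrow> continuous_on S w"
  by (induction rule: trig_poly.induct) (intro continuous_intros; assumption?)+

text \<open>
  The restriction \<open>g\<close> of \<open>f\<close> to the circle is orthogonal to all trigonometric polynomials. Polynomials
  in the plane approximate \<open>f\<close> uniformly on a disc and restrict to trigonometric
  polynomials, so the integral of \<open>g\<^sup>2\<close> is arbitrarily small.
\<close>

lemma eq_0_if_circle_moments_eq_0:
  fixes f :: "real^2 \<Rightarrow> real"
  assumes cont: "continuous_on UNIV f"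
    and moments: "\<And>n \<gamma>. circle_moment f (\<lambda>\<theta>. cos (real_of_int n * \<theta> - \<gamma>)) \<rho> = 0"
    and \<theta>: "0 \<le> \<theta>" "\<theta> \<le> 2 * pi"
  shows "f (\<rho> *\<^sub>R unit_dir \<theta>) = 0"
proof -
  define g where "g \<theta> = f (\<rho> *\<^sub>R unit_dir \<theta>)" for \<theta>
  have contg: "continuous_on S g" for S
    unfolding g_def by (intro continuous_on_compose2[OF cont] continuous_intros) auto
  have int: "(\<lambda>\<theta>. g \<theta> * w \<theta>) integrable_on {0..2 * pi}" if "trig_poly w" for w
    by (intro integrable_continuous_interval continuous_intros contg continuous_on_trig_poly that)
  have orth: "integral {0..2 * pi} (\<lambda>\<theta>. g \<theta> * w \<theta>) = 0" if "trig_poly w" for w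
    using that
  proof induction
    case (wave c n \<gamma>)
    have "integral {0..2 * pi} (\<lambda>\<theta>. g \<theta> * (c * cos (real_of_int n * \<theta> - \<gamma>))) =
        integral {0..2 * pi} (\<lambda>\<theta>. c * (g \<theta> * cos (real_of_int n * \<theta> - \<gamma>)))"
      by (simp only: mult_ac)
    then show ?case using moments[of n \<gamma>] by (simp add: circle_moment_def g_def)
  next
    case (add v w)
    then show ?case
      unfolding distrib_left by (subst integral_add) (auto intro: int)
  qed
  define N where "N = integral {0..2 * pi} (\<lambda>\<theta>. \<bar>g \<theta>\<bar>)"
  define I where "I = integral {0..2 * pi} (\<lambda>\<theta>. g \<theta> * g \<theta>)"
  have le: "I \<le> N * e" if "0 < e" for e
  proof -
    obtain P where P: "real_polynomial_function P"
      "\<And>x. x \<in> cball 0 \<bar>\<rho>\<bar> \<Longrightarrow> \<bar>f x - P x\<bar> < e"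
      by (rule Stone_Weierstrass_real_polynomial_function
            [OF compact_cball[of 0 "\<bar>\<rho>\<bar>"] continuous_on_subset[OF cont subset_UNIV] \<open>0 < e\<close>])
         (blast intro: that)
    define w where "w \<theta> = P (\<rho> *\<^sub>R unit_dir \<theta>)" for \<theta>
    have w: "trig_poly w"
      unfolding w_def by (rule trig_poly_real_polynomial_on_circle[OF P(1)])
    have close: "\<bar>g \<theta> - w \<theta>\<bar> \<le> e" for \<theta>
      using P(2)[of "\<rho> *\<^sub>R unit_dir \<theta>"] by (simp add: g_def w_def)
    have "I = integral {0..2 * pi} (\<lambda>\<theta>. g \<theta> * g \<theta>) - integral {0..2 * pi} (\<lambda>\<theta>. g \<theta> * w \<theta>)"
      using orth[OF w] by (simp add: I_def)
    also have "\<dots> = integral {0..2 * pi} (\<lambda>\<theta>. g \<theta> * g \<theta> - g \<theta> * w \<theta>)"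
      by (intro integral_diff[symmetric] int w integrable_continuous_interval continuous_intros contg)
    also have "\<dots> \<le> integral {0..2 * pi} (\<lambda>\<theta>. \<bar>g \<theta>\<bar> * e)"
    proof (rule integral_le)
      show "g \<theta> * g \<theta> - g \<theta> * w \<theta> \<le> \<bar>g \<theta>\<bar> * e" for \<theta>
      proof -
        have "g \<theta> * g \<theta> - g \<theta> * w \<theta> \<le> \<bar>g \<theta> * (g \<theta> - w \<theta>)\<bar>" by (simp add: right_diff_distrib)
        also have "\<dots> \<le> \<bar>g \<theta>\<bar> * e" unfolding abs_mult by (intro mult_left_mono close) auto
        finally show ?thesis .
      qed
    qed (intro integrable_continuous_interval continuous_intros contg continuous_on_trig_poly w)+
    finally show ?thesis by (simp add: N_def)
  qed
  have "I \<le> 0"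
  proof (rule field_le_epsilon)
    fix e :: real assume "0 < e"
    have "0 \<le> N" unfolding N_def
      by (intro integral_nonneg integrable_continuous_interval continuous_intros contg) auto
    have "I \<le> N * (e / (N + 1))" using \<open>0 < e\<close> \<open>0 \<le> N\<close> by (intro le) auto
    also have "\<dots> \<le> e" using \<open>0 < e\<close> \<open>0 \<le> N\<close> by (simp add: divide_le_eq field_simps)
    finally show "I \<le> 0 + e" by simp
  qed
  moreover have "0 \<le> I" unfolding I_def
    by (intro integral_nonneg integrable_continuous_interval continuous_intros contg) auto
  ultimately have "I = 0" by simp
  have "\<forall>\<theta>\<in>{0..2 * pi}. g \<theta> * g \<theta> = 0"
  proof -
    have "continuous_on {0..2 * pi} (\<lambda>\<theta>. g \<theta> * g \<theta>)" by (intro continuous_intros contg)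
    from integral_eq_0_iff[OF this] show ?thesis using \<open>I = 0\<close> by (simp add: I_def)
  qed
  then show ?thesis using \<theta> by (simp add: g_def)
qed

section \<open>Uniqueness for the V-line transform\<close>

lemma polar_decomposition:
  fixes x :: "real^2"
  obtains \<theta> where "0 \<le> \<theta>" "\<theta> \<le> 2 * pi" "x = norm x *\<^sub>R unit_dir \<theta>"
proof (cases "x = 0")
  case False
  have "(norm x)\<^sup>2 = (x $ 1)\<^sup>2 + (x $ 2)\<^sup>2"
    by (simp add: norm_vec_def L2_set_def sum_2)
  then have "(x $ 1 / norm x)\<^sup>2 + (x $ 2 / norm x)\<^sup>2 = (norm x)\<^sup>2 / (norm x)\<^sup>2"
    by (simp only: power_divide add_divide_distrib)
  also have "\<dots> = 1" using False by simp
  finally have "(x $ 1 / norm x)\<^sup>2 + (x $ 2 / norm x)\<^sup>2 = 1" .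
  then obtain \<theta> where \<theta>: "0 \<le> \<theta>" "\<theta> < 2 * pi" "x $ 1 / norm x = cos \<theta>" "x $ 2 / norm x = sin \<theta>"
    using sincos_total_2pi by metis
  then have "x $ 1 = norm x * cos \<theta>" "x $ 2 = norm x * sin \<theta>"
    using False by (simp_all add: divide_eq_eq mult.commute)
  then have "x = norm x *\<^sub>R unit_dir \<theta>"
    by (simp add: vec_eq_iff forall_2 unit_dir_def)
  with \<theta> show ?thesis by (intro that[of \<theta>]) simp_all
qed (use that[of 0] in simp)

lemma C_diff_diff:
  assumes "C_diff k f" "C_diff k g"
  shows "C_diff k (\<lambda>x. f x - g x)"
  using assms
proof (induction k arbitrary: f g)
  case 0
  then show ?case by (auto intro: continuous_on_diff)
next
  case (Suc k)
  have fd: "frechet_derivative (\<lambda>x. f x - g x) (at x) =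
      (\<lambda>v. frechet_derivative f (at x) v - frechet_derivative g (at x) v)" for x
    using Suc.prems by (intro frechet_derivative_at[symmetric] has_derivative_diff)
      (auto simp: frechet_derivative_works[symmetric])
  show ?case
    using Suc by (auto simp: fd)
qed

lemma smooth_diff: "smooth f \<Longrightarrow> smooth g \<Longrightarrow> smooth (\<lambda>x. f x - g x)"
  by (simp add: smooth_def C_diff_diff)

lemma Cc_infty_disc_vanishing_radius:
  assumes "f \<in> Cc_infty_disc R" "0 < R"
  obtains R' where "0 < R'" "R' < R" "\<And>x. R' \<le> norm x \<Longrightarrow> f x = 0"
proof -
  have sub: "supp f \<subseteq> ball 0 R" using assms by (simp add: Cc_infty_disc_def disc_def)
  then have "bounded (supp f)" by (rule bounded_subset[OF bounded_ball])
  moreover have "closed (supp f)" by (simp add: supp_def)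
  ultimately have "compact (supp f)" by (simp add: compact_eq_bounded_closed)
  have f0: "f x = 0" if "x \<notin> supp f" for x
    using that closure_subset[of "{x. f x \<noteq> 0}"] by (auto simp: supp_def)
  show ?thesis
  proof (cases "supp f = {}")
    case True
    then show ?thesis using f0 assms(2) by (intro that[of "R / 2"]) auto
  next
    case False
    obtain y where y: "y \<in> supp f" "\<And>x. x \<in> supp f \<Longrightarrow> norm x \<le> norm y"
      using continuous_attains_sup[OF \<open>compact (supp f)\<close> False continuous_on_norm_id] by metis
    have "norm y < R" using y(1) sub by auto
    show ?thesis
    proof (rule that[of "(norm y + R) / 2"])
      show "f x = 0" if "(norm y + R) / 2 \<le> norm x" for x
        using that y(2)[of x] \<open>norm y < R\<close> by (intro f0) auto
      show "0 < (norm y + R) / 2" using \<open>0 < R\<close> by (simp add: add_nonneg_pos)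
    qed (use \<open>norm y < R\<close> in auto)
  qed
qed

lemma vline_transform_diff:
  fixes f g :: "real^2 \<Rightarrow> real"
  assumes "continuous_on UNIV f" "\<And>x. R \<le> norm x \<Longrightarrow> f x = 0"
    and "continuous_on UNIV g" "\<And>x. R \<le> norm x \<Longrightarrow> g x = 0" and "0 < R"
  shows "vline_transform R \<mu> (\<lambda>x. f x - g x) \<phi> \<psi> = vline_transform R \<mu> f \<phi> \<psi> - vline_transform R \<mu> g \<phi> \<psi>"
proof -
  have int: "(\<lambda>r. h (R *\<^sub>R unit_dir \<phi> - r *\<^sub>R unit_dir \<theta>) * exp (- \<mu> * r)) integrable_on {0..2 * R}"
    if "continuous_on UNIV h" for h :: "real^2 \<Rightarrow> real" and \<theta>
    by (intro integrable_continuous_interval continuous_intros continuous_on_compose2[OF that]) auto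
  have fg: "vline_transform R \<mu> f \<phi> \<psi> =
    integral {0..2 * R} (\<lambda>r. f (R *\<^sub>R unit_dir \<phi> - r *\<^sub>R unit_dir (\<phi> - \<psi>)) * exp (- \<mu> * r)) +
    integral {0..2 * R} (\<lambda>r. f (R *\<^sub>R unit_dir \<phi> - r *\<^sub>R unit_dir (\<phi> + \<psi>)) * exp (- \<mu> * r))"
    "vline_transform R \<mu> g \<phi> \<psi> =
    integral {0..2 * R} (\<lambda>r. g (R *\<^sub>R unit_dir \<phi> - r *\<^sub>R unit_dir (\<phi> - \<psi>)) * exp (- \<mu> * r)) +
    integral {0..2 * R} (\<lambda>r. g (R *\<^sub>R unit_dir \<phi> - r *\<^sub>R unit_dir (\<phi> + \<psi>)) * exp (- \<mu> * r))"
    by (rule vline_transform_eq_integral; use assms in simp)+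
  have "continuous_on UNIV (\<lambda>x. f x - g x)" by (intro continuous_on_diff assms)
  then have "vline_transform R \<mu> (\<lambda>x. f x - g x) \<phi> \<psi> =
    integral {0..2 * R} (\<lambda>r. (f (R *\<^sub>R unit_dir \<phi> - r *\<^sub>R unit_dir (\<phi> - \<psi>))
      - g (R *\<^sub>R unit_dir \<phi> - r *\<^sub>R unit_dir (\<phi> - \<psi>))) * exp (- \<mu> * r)) +
    integral {0..2 * R} (\<lambda>r. (f (R *\<^sub>R unit_dir \<phi> - r *\<^sub>R unit_dir (\<phi> + \<psi>))
      - g (R *\<^sub>R unit_dir \<phi> - r *\<^sub>R unit_dir (\<phi> + \<psi>))) * exp (- \<mu> * r))"
    by (rule vline_transform_eq_integral) (use assms in auto)
  then show ?thesis
    unfolding fg left_diff_distrib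
    by (simp add: integral_diff[OF int[OF assms(1), simplified] int[OF assms(3), simplified]])
qed

theorem corollary3p3:
  fixes R \<mu> :: real and f1 f2 :: "real^2 \<Rightarrow> real"
  assumes "R > 0" and "\<mu> * R \<le> 3 / 2"
    and "f1 \<in> Cc_infty_disc R" and "f2 \<in> Cc_infty_disc R"
    and "\<forall>\<phi>\<in>{0..<2 * pi}. \<forall>\<psi>\<in>{0<..<pi / 2}.
           vline_transform R \<mu> f1 \<phi> \<psi> = vline_transform R \<mu> f2 \<phi> \<psi>"
  shows "f1 = f2"
proof -
  define f where "f x = f1 x - f2 x" for x
  have smooth: "smooth f1" "smooth f2" using assms(3,4) by (auto simp: Cc_infty_disc_def)
  then have f: "smooth f" unfolding f_def by (rule smooth_diff)
  obtain R1 where R1: "0 < R1" "R1 < R" "\<And>x. R1 \<le> norm x \<Longrightarrow> f1 x = 0"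
    using Cc_infty_disc_vanishing_radius[OF assms(3,1)] by blast
  obtain R2 where R2: "0 < R2" "R2 < R" "\<And>x. R2 \<le> norm x \<Longrightarrow> f2 x = 0"
    using Cc_infty_disc_vanishing_radius[OF assms(4,1)] by blast
  have V: "vline_transform R \<mu> f \<phi> \<psi> = 0"
    if "0 \<le> \<phi>" "\<phi> < 2 * pi" "0 < \<psi>" "\<psi> < pi / 2" for \<phi> \<psi>
  proof -
    have "f1 x = 0" "f2 x = 0" if "R \<le> norm x" for x
      using R1(2,3) R2(2,3) that by simp_all
    then have "vline_transform R \<mu> f \<phi> \<psi> = vline_transform R \<mu> f1 \<phi> \<psi> - vline_transform R \<mu> f2 \<phi> \<psi>"
      unfolding f_def[abs_def]
      by (intro vline_transform_diff smooth_imp_continuous_on smooth \<open>R > 0\<close>)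
    then show ?thesis using that assms(5) by simp
  qed
  have moments: "circle_moment f (\<lambda>\<theta>. cos (real_of_int n * \<theta> - \<gamma>)) \<rho> = 0" if "0 < \<rho>" for n \<gamma> \<rho>
  proof (rule circle_moment_eq_0[OF f])
    show "f x = 0" if "max R1 R2 \<le> norm x" for x
      using that R1(3)[of x] R2(3)[of x] by (simp add: f_def)
    show "0 < max R1 R2" "max R1 R2 < R" using R1 R2 by simp_all
  qed (use V that in auto)
  have nonzero: "f x = 0" if "x \<noteq> 0" for x
  proof -
    obtain \<theta> where \<theta>: "0 \<le> \<theta>" "\<theta> \<le> 2 * pi" "x = norm x *\<^sub>R unit_dir \<theta>"
      by (rule polar_decomposition)
    have "f (norm x *\<^sub>R unit_dir \<theta>) = 0"
      by (rule eq_0_if_circle_moments_eq_0[OF smooth_imp_continuous_on[OF f] _ \<theta>(1,2)])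
         (use that moments in simp)
    with \<theta>(3) show ?thesis by simp
  qed
  have "f x = 0" for x
  proof (rule continuous_constant_on_closure[where f = f and S = "- {0}"])
    show "continuous_on (closure (- {0})) f" by (rule smooth_imp_continuous_on[OF f])
    show "x \<in> closure (- {0})" by (simp add: closure_complement)
  qed (use nonzero in auto)
  then show ?thesis by (simp add: f_def fun_eq_iff)
qed

end
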